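(* Let $0<p<1$ and let $1\le k\le n$ be integers. Let $T(n,p)$ be the random threshold graph with parameters $n$ and $p$, and let $\lambda(T(n,p))$ be its associated anti-lecture hall composition. Then $$\mathbb{E}\big(\lambda_k(T(n,p))\big)=\sum_{i=k}^{n}(-1)^{i+k}\binom{n+1}{i+1}\binom{i-1}{k-1}\frac{p(1-p^i)}{1-p}.$$
   Context: For $n\ge 1$ and $\sigma\subseteq\{1,\dots,n\}$, $T(n,\sigma)$ is the (threshold) graph with vertex set $\{0,1,\dots,n\}$ in which, for $0\le u<v\le n$, the pair $uv$ is an edge if and only if $v\notin\sigma$. The random threshold graph $T(n,p)$, for $p\in[0,1]$, is $T(n,\sigma)$ where $\sigma$ is the random subset of $\{1,\dots,n\}$ containing each $i$ independently with probability $p$. Let $\Bbbk$ be a field and $R=\Bbbk[x_0,\dots,x_n]$. For a threshold graph $T=T(n,\sigma)$, let $I_c(T)=\langle x_ux_v\mid u\neq v,\ uv\notin E(T)\rangle$ and $\Bbbk[T]=R/I_c(T)$. The graded Betti numbers $\beta_{i,j}(\Bbbk[T])$ vanish unless $j=i+1$ or $(i,j)=(0,0)$; set $\beta_k(T)=\beta_{k,k+1}(\Bbbk[T])$ for $1\le k\le n$. The anti-lecture hall composition associated to $T$ is $\lambda(T)=(\lambda_1(T),\dots,\lambda_n(T))$ with $$\lambda_i(T)=\sum_{k=i}^n(-1)^{i+k}\binom{k-1}{i-1}\beta_k(T).$$ It is an integer sequence satisfying $1\ge\lambda_1/1\ge\lambda_2/2\ge\cdots\ge\lambda_n/n\ge0$.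 *)

theory Defs
  imports
    "HOL-Probability.Probability"
    "HOL-Library.Poly_Mapping"
    "Jordan_Normal_Form.Matrix"
begin

(* A simple graph: its vertex set and its set of edges, each edge being a two-element set. *)
type_synonym graph = "nat set \<times> nat set set"

definition threshold_graph :: "nat \<Rightarrow> nat set \<Rightarrow> graph" where
  "threshold_graph n \<sigma> = ({0..n}, {{u, v} | u v. u < v \<and> v \<le> n \<and> v \<notin> \<sigma>})"

definition random_subset :: "nat \<Rightarrow> real \<Rightarrow> nat set pmf" where
  "random_subset n p =
     map_pmf (\<lambda>b. {i \<in> {1..n}. b i}) (Pi_pmf {1..n} False (\<lambda>_. bernoulli_pmf p))"

definition random_threshold_graph :: "nat \<Rightarrow> real \<Rightarrow> graph pmf" where
  "random_threshold_graph n p = map_pmf (threshold_graph n) (random_subset n p)"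

(* Polynomials are finitely supported maps from monomials (exponent functions) to coefficients.
   The type has variables x_v for every natural number v; the ring k[x_v | v in V] is the
   subset poly_ring V. *)
type_synonym 'k polynomial = "(nat \<Rightarrow>\<^sub>0 nat) \<Rightarrow>\<^sub>0 'k"

definition poly_ring :: "nat set \<Rightarrow> 'k::field polynomial set" where
  "poly_ring V = {f. \<forall>m \<in> Poly_Mapping.keys f. Poly_Mapping.keys m \<subseteq> V}"

definition poly_var :: "nat \<Rightarrow> 'k::field polynomial" where
  "poly_var v = Poly_Mapping.single (Poly_Mapping.single v 1) 1"

definition monom_degree :: "(nat \<Rightarrow>\<^sub>0 nat) \<Rightarrow> nat" where
  "monom_degree m = (\<Sum>v \<in> Poly_Mapping.keys m. Poly_Mapping.lookup m v)"

(* The zero polynomial is homogeneous of every degree. *)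
definition homogeneous :: "int \<Rightarrow> 'k::field polynomial \<Rightarrow> bool" where
  "homogeneous d f \<longleftrightarrow> (\<forall>m \<in> Poly_Mapping.keys f. int (monom_degree m) = d)"

(* The ideal of poly_ring V generated by a finite set S. *)
definition ideal_gen :: "nat set \<Rightarrow> 'k::field polynomial set \<Rightarrow> 'k polynomial set" where
  "ideal_gen V S = {\<Sum>g\<in>S. c g * g | c. \<forall>g\<in>S. c g \<in> poly_ring V}"

definition free_module :: "nat set \<Rightarrow> nat \<Rightarrow> 'k::field polynomial vec set" where
  "free_module V r = {w \<in> carrier_vec r. \<forall>a<r. vec_index w a \<in> poly_ring V}"

(* With R = poly_ring V and I a homogeneous ideal of R, this says that
     ... --> F_2 --D 2--> F_1 --D 1--> F_0 --e--> R/I --> 0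
   is a minimal graded free resolution of R/I. Here F_i is the direct sum of the R(-d) for d in
   the list ds i, the differentials are given by matrices, and the augmentation is
   w |-> (e . w) + I, so the entries of e represent the images of the basis vectors of F_0.
   D 0 is not used. Minimality, D i (F_i) <= (x_v | v in V) F_(i-1), means that the entries of
   the matrices have no constant term. *)
definition minimal_graded_free_resolution ::
  "nat set \<Rightarrow> 'k::field polynomial set \<Rightarrow> (nat \<Rightarrow> int list) \<Rightarrow> 'k polynomial vec
     \<Rightarrow> (nat \<Rightarrow> 'k polynomial mat) \<Rightarrow> bool" where
  "minimal_graded_free_resolution V I ds e D \<longleftrightarrow>
     (let F = (\<lambda>i. free_module V (length (ds i))) in
       e \<in> F 0 \<and>
       (\<forall>a < length (ds 0). homogeneous (ds 0 ! a) (vec_index e a)) \<and>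
       (\<forall>i. D (Suc i) \<in> carrier_mat (length (ds i)) (length (ds (Suc i))) \<and>
            (\<forall>b < length (ds i). \<forall>a < length (ds (Suc i)).
               D (Suc i) $$ (b, a) \<in> poly_ring V \<and>
               homogeneous (ds (Suc i) ! a - ds i ! b) (D (Suc i) $$ (b, a)) \<and>
               Poly_Mapping.lookup (D (Suc i) $$ (b, a)) 0 = 0)) \<and>
       (\<forall>f \<in> poly_ring V. \<exists>w \<in> F 0. f - e \<bullet> w \<in> I) \<and>
       {w \<in> F 0. e \<bullet> w \<in> I} = (\<lambda>w. D 1 *\<^sub>v w) ` F 1 \<and>
       (\<forall>i. {w \<in> F (Suc i). D (Suc i) *\<^sub>v w = 0\<^sub>v (length (ds i))}
              = (\<lambda>w. D (Suc (Suc i)) *\<^sub>v w) ` F (Suc (Suc i))))"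

(* The graded Betti number of R/I, where R = poly_ring V: the number of summands R(-j) of F_i in
   a minimal graded free resolution of R/I. *)
definition graded_betti ::
  "nat set \<Rightarrow> 'k::field polynomial set \<Rightarrow> nat \<Rightarrow> int \<Rightarrow> nat" where
  "graded_betti V I i j =
     (THE b. \<exists>ds e D. minimal_graded_free_resolution V I ds e D \<and> b = count_list (ds i) j)"

definition complement_edge_ideal :: "graph \<Rightarrow> 'k::field polynomial set" where
  "complement_edge_ideal T =
     ideal_gen (fst T)
       {poly_var u * poly_var v | u v. u \<in> fst T \<and> v \<in> fst T \<and> u \<noteq> v \<and> {u, v} \<notin> snd T}"

definition linear_betti :: "'k::field itself \<Rightarrow> graph \<Rightarrow> nat \<Rightarrow> nat" where
  "linear_betti _ T k =
     graded_betti (fst T) (complement_edge_ideal T :: 'k polynomial set) k (int k + 1)"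

(* The i-th part of lambda(T), for i >= 1, where T has n + 1 vertices. *)
definition anti_lecture_hall :: "'k::field itself \<Rightarrow> graph \<Rightarrow> nat \<Rightarrow> int" where
  "anti_lecture_hall K T i =
     (let n = card (fst T) - 1 in
       \<Sum>k=i..n. (-1) ^ (i + k) * int ((k - 1) choose (i - 1)) * int (linear_betti K T k))"

end

theory Submission
  imports Defs "Jordan_Normal_Form.Determinant"
begin

text \<open>Order the monomials \<open>x\<^sub>u x\<^sub>v\<close> with \<open>u < v\<close> and \<open>v \<in> \<sigma>\<close> by \<open>v\<close> and then by \<open>u\<close>. The
  ideal of the earlier monomials then has at \<open>x\<^sub>u x\<^sub>v\<close> the colon ideal generated by the variables
  \<open>x\<^sub>w\<close> with \<open>w < u\<close>, or \<open>u < w < v\<close> and \<open>w \<in> \<sigma>\<close>. Iterated mapping cones over Koszul resolutions give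
  a resolution of \<open>k[T]\<close>, minimal for degree reasons, and
  \<open>\<beta>\<^sub>k = (\<Sum>v\<in>\<sigma>. \<Sum>u<v. (u + card (\<sigma> \<inter> {u<..<v})) choose (k - 1))\<close>. Betti numbers do not depend on
  the resolution, as comparison maps between two minimal resolutions are inverse to each other modulo
  the variables. Expanding by Vandermonde and using that a fixed set \<open>B\<close> lies in \<open>\<sigma>\<close> with probability
  \<open>p ^ card B\<close>, the expectation of \<open>\<beta>\<^sub>k\<close> becomes
  \<open>((n + 1) choose (k + 1)) * (p + p\<^sup>2 + \<dots> + p\<^sup>k)\<close>.\<close>

unbundle no inner_syntax and no vec_syntax

section \<open>Polynomials and matrices of polynomials\<close>

text \<open>\<open>graded_betti\<close> is a definite description over all minimal resolutions, so
  an explicit resolution determines nothing without uniqueness, and uniqueness must hold degree by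
  degree, not only for ranks. Both halves rest on one comparison theorem for multiplication by a
  homogeneous element: with the element 1 it compares two resolutions, with a monomial it supplies
  the map whose cone is taken.

  The order of the generators makes every colon ideal an ideal of variables. A new generator of
  degree 2 then contributes in homological degree i a Koszul module in degree (i - 1) + 2 = i + 1,
  while the comparison map goes from degree i + 2 to degree i + 1 (or 0), so it has no constant
  entries. The field never matters.

  The geometric sum has a counting reason: v, u, s vertices strictly between them and k - 1 - s
  vertices below u form a (k + 1)-subset of {0..n}, and once s is known the subset determines u and
  v. So every s from 0 to k - 1 has the same coefficient; its weight is p^(s + 1), as v and the s
  vertices in between must lie in \<sigma>.\<close>

lemma poly_ring_zero [simp]: "0 \<in> poly_ring V"
  and poly_ring_one [simp]: "1 \<in> poly_ring V"
  by (auto simp: poly_ring_def)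

lemma poly_ring_uminus: "f \<in> poly_ring V \<Longrightarrow> - f \<in> poly_ring V"
  by (simp add: poly_ring_def in_keys_iff)

lemma poly_ring_add: "f \<in> poly_ring V \<Longrightarrow> g \<in> poly_ring V \<Longrightarrow> f + g \<in> poly_ring V"
  using Poly_Mapping.keys_add[of f g] by (auto simp: poly_ring_def)

lemma poly_ring_diff: "f \<in> poly_ring V \<Longrightarrow> g \<in> poly_ring V \<Longrightarrow> f - g \<in> poly_ring V"
  using poly_ring_add[of f V "- g"] poly_ring_uminus[of g V] by simp

lemma keys_multE:
  assumes "m \<in> Poly_Mapping.keys (f * g)"
  obtains a b where "m = a + b" "a \<in> Poly_Mapping.keys f" "b \<in> Poly_Mapping.keys g"
  using subsetD[OF Poly_Mapping.keys_mult assms] by blast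

lemma poly_ring_mult:
  assumes "f \<in> poly_ring V" "g \<in> poly_ring V"
  shows "f * g \<in> poly_ring V"
proof -
  have "Poly_Mapping.keys m \<subseteq> V" if "m \<in> Poly_Mapping.keys (f * g)" for m
  proof -
    obtain a b where "m = a + b" "a \<in> Poly_Mapping.keys f" "b \<in> Poly_Mapping.keys g"
      by (rule keys_multE[OF \<open>m \<in> Poly_Mapping.keys (f * g)\<close>])
    then show ?thesis
      using assms Poly_Mapping.keys_add[of a b] unfolding poly_ring_def by blast
  qed
  then show ?thesis by (simp add: poly_ring_def)
qed

lemma poly_ring_sum: "(\<And>x. x \<in> A \<Longrightarrow> f x \<in> poly_ring V) \<Longrightarrow> (\<Sum>x\<in>A. f x) \<in> poly_ring V"
  by (induction A rule: infinite_finite_induct) (auto simp: poly_ring_add)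

lemma poly_ring_single: "Poly_Mapping.keys m \<subseteq> V \<Longrightarrow> Poly_Mapping.single m c \<in> poly_ring V"
  by (cases "c = 0") (auto simp: poly_ring_def)

section \<open>Degrees and constant terms\<close>

lemma keys_add_nat:
  fixes a b :: "nat \<Rightarrow>\<^sub>0 nat"
  shows "Poly_Mapping.keys (a + b) = Poly_Mapping.keys a \<union> Poly_Mapping.keys b"
  by (auto simp: in_keys_iff lookup_add)

lemma monom_degree_add: "monom_degree (a + b) = monom_degree a + monom_degree b"
proof -
  let ?A = "Poly_Mapping.keys a \<union> Poly_Mapping.keys b"
  have "monom_degree a = (\<Sum>v\<in>?A. Poly_Mapping.lookup a v)"
       "monom_degree b = (\<Sum>v\<in>?A. Poly_Mapping.lookup b v)"
    unfolding monom_degree_def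
    by (intro sum.mono_neutral_left; auto simp: in_keys_iff)+
  then show ?thesis
    by (simp add: monom_degree_def keys_add_nat lookup_add sum.distrib)
qed

lemma homogeneous_zero [simp]: "homogeneous d 0"
  by (simp add: homogeneous_def)

lemma homogeneous_one [simp]: "homogeneous 0 1"
  by (simp add: homogeneous_def monom_degree_def)

lemma homogeneous_uminus: "homogeneous d f \<Longrightarrow> homogeneous d (- f)"
  by (simp add: homogeneous_def in_keys_iff)

lemma homogeneous_add: "homogeneous d f \<Longrightarrow> homogeneous d g \<Longrightarrow> homogeneous d (f + g)"
  using Poly_Mapping.keys_add[of f g] by (auto simp: homogeneous_def)

lemma homogeneous_mult:
  assumes "homogeneous c f" "homogeneous d g"
  shows "homogeneous (c + d) (f * g)"
proof -
  have "int (monom_degree m) = c + d" if "m \<in> Poly_Mapping.keys (f * g)" for m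
  proof -
    obtain a b where "m = a + b" "a \<in> Poly_Mapping.keys f" "b \<in> Poly_Mapping.keys g"
      by (rule keys_multE[OF \<open>m \<in> Poly_Mapping.keys (f * g)\<close>])
    then show ?thesis
      using assms by (auto simp: homogeneous_def monom_degree_add)
  qed
  then show ?thesis by (simp add: homogeneous_def)
qed

lemma homogeneous_sum: "(\<And>x. x \<in> A \<Longrightarrow> homogeneous d (f x)) \<Longrightarrow> homogeneous d (\<Sum>x\<in>A. f x)"
  by (induction A rule: infinite_finite_induct) (auto simp: homogeneous_add)

lemma homogeneous_lookup_0:
  assumes "homogeneous d f" "d \<noteq> 0"
  shows "Poly_Mapping.lookup f 0 = 0"
proof (rule ccontr)
  assume "Poly_Mapping.lookup f 0 \<noteq> 0"
  then have "int (monom_degree 0) = d"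
    using assms(1) by (simp add: homogeneous_def in_keys_iff)
  then show False using assms(2) by (simp add: monom_degree_def)
qed

text \<open>Taking constant terms is the ring map to the residue field, used to reduce matrices
  modulo the variables. It is multiplicative because natural exponents add up to zero only if both
  vanish.\<close>

lemma lookup_0_mult:
  fixes f g :: "'k::field polynomial"
  shows "Poly_Mapping.lookup (f * g) 0 = Poly_Mapping.lookup f 0 * Poly_Mapping.lookup g 0"
proof -
  have *: "Poly_Mapping.lookup (a * b) 0 = 0" if "Poly_Mapping.lookup a 0 = 0"
    for a b :: "'k polynomial"
  proof (rule ccontr)
    assume "Poly_Mapping.lookup (a * b) 0 \<noteq> 0"
    then obtain k l where kl: "0 = k + l" "k \<in> Poly_Mapping.keys a"
      using Poly_Mapping.keys_mult[of a b] by (auto simp: in_keys_iff)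
    have "k = 0"
    proof (rule poly_mapping_eqI)
      fix v
      have "0 = Poly_Mapping.lookup k v + Poly_Mapping.lookup l v"
        using kl(1) by (metis lookup_add lookup_zero)
      then show "Poly_Mapping.lookup k v = Poly_Mapping.lookup 0 v" by simp
    qed
    with kl that show False by (simp add: in_keys_iff)
  qed
  let ?c = "\<lambda>h::'k polynomial. Poly_Mapping.single 0 (Poly_Mapping.lookup h 0) :: 'k polynomial"
  have eq: "f * g = (f - ?c f) * g + (g - ?c g) * ?c f + ?c f * ?c g"
    by (simp add: algebra_simps)
  have "Poly_Mapping.lookup (f * g) 0 = Poly_Mapping.lookup (?c f * ?c g) 0"
    by (subst eq) (simp add: * lookup_minus lookup_add)
  then show ?thesis by (simp add: mult_single)
qed

text \<open>Both the homogeneous components and the part of a polynomial outside a monomial ideal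
  arise this way.\<close>

definition restrict_keys :: "('a \<Rightarrow> bool) \<Rightarrow> ('a \<Rightarrow>\<^sub>0 'b::comm_monoid_add) \<Rightarrow> 'a \<Rightarrow>\<^sub>0 'b" where
  "restrict_keys P f =
     (\<Sum>m\<in>{m \<in> Poly_Mapping.keys f. P m}. Poly_Mapping.single m (Poly_Mapping.lookup f m))"

lemma lookup_restrict_keys:
  "Poly_Mapping.lookup (restrict_keys P f) m = (if P m then Poly_Mapping.lookup f m else 0)"
  by (auto simp: restrict_keys_def lookup_sum lookup_single when_def sum.delta in_keys_iff)

lemma keys_restrict_keys: "Poly_Mapping.keys (restrict_keys P f) = {m \<in> Poly_Mapping.keys f. P m}"
  by (auto simp: in_keys_iff lookup_restrict_keys split: if_splits)

lemma restrict_keys_add: "restrict_keys P (f + g) = restrict_keys P f + restrict_keys P g"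
  by (rule poly_mapping_eqI) (simp add: lookup_restrict_keys lookup_add)

lemma restrict_keys_zero [simp]: "restrict_keys P 0 = 0"
  by (rule poly_mapping_eqI) (simp add: lookup_restrict_keys)

lemma restrict_keys_diff:
  fixes f g :: "'a \<Rightarrow>\<^sub>0 'b::ab_group_add"
  shows "restrict_keys P (f - g) = restrict_keys P f - restrict_keys P g"
  by (rule poly_mapping_eqI) (simp add: lookup_restrict_keys lookup_minus)

lemma restrict_keys_sum: "restrict_keys P (\<Sum>x\<in>A. f x) = (\<Sum>x\<in>A. restrict_keys P (f x))"
  by (induction A rule: infinite_finite_induct) (auto simp: restrict_keys_add)

lemma restrict_keys_split: "f = restrict_keys P f + restrict_keys (\<lambda>m. \<not> P m) f"
  by (rule poly_mapping_eqI) (simp add: lookup_restrict_keys lookup_add)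

lemma restrict_keys_id: "(\<And>m. m \<in> Poly_Mapping.keys f \<Longrightarrow> P m) \<Longrightarrow> restrict_keys P f = f"
  by (rule poly_mapping_eqI) (auto simp: lookup_restrict_keys in_keys_iff)

lemma restrict_keys_empty: "(\<And>m. m \<in> Poly_Mapping.keys f \<Longrightarrow> \<not> P m) \<Longrightarrow> restrict_keys P f = 0"
  by (rule poly_mapping_eqI) (auto simp: lookup_restrict_keys in_keys_iff)

lemma poly_ring_restrict_keys: "f \<in> poly_ring V \<Longrightarrow> restrict_keys P f \<in> poly_ring V"
  by (simp add: poly_ring_def keys_restrict_keys)

definition hom_part :: "int \<Rightarrow> 'k::field polynomial \<Rightarrow> 'k polynomial" where
  "hom_part d = restrict_keys (\<lambda>m. int (monom_degree m) = d)"

lemma homogeneous_hom_part: "homogeneous d (hom_part d f)"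
  by (simp add: homogeneous_def hom_part_def keys_restrict_keys)

lemma hom_part_id: "homogeneous d f \<Longrightarrow> hom_part d f = f"
  unfolding hom_part_def by (rule restrict_keys_id) (auto simp: homogeneous_def)

text \<open>A homogeneous factor shifts all degrees equally, so only the component of degree
  \<open>d\<close> of \<open>f\<close> reaches degree \<open>c + d\<close>. Hence any solution of a
  linear system with homogeneous data can be truncated to a homogeneous one.\<close>

lemma hom_part_mult:
  assumes "homogeneous c g"
  shows "hom_part (c + d) (g * f) = g * hom_part d f"
proof -
  let ?r = "restrict_keys (\<lambda>m. int (monom_degree m) \<noteq> d) f"
  have split: "g * f = g * hom_part d f + g * ?r"
    using restrict_keys_split[of f "\<lambda>m. int (monom_degree m) = d"]
    by (simp add: hom_part_def flip: distrib_left)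
  moreover have "hom_part (c + d) (g * hom_part d f) = g * hom_part d f"
    by (intro hom_part_id homogeneous_mult assms homogeneous_hom_part)
  moreover have "hom_part (c + d) (g * ?r) = 0"
    unfolding hom_part_def
  proof (rule restrict_keys_empty)
    fix m assume "m \<in> Poly_Mapping.keys (g * ?r)"
    then obtain a b where "m = a + b" "a \<in> Poly_Mapping.keys g" "b \<in> Poly_Mapping.keys ?r"
      by (rule keys_multE)
    then show "int (monom_degree m) \<noteq> c + d"
      using assms by (auto simp: homogeneous_def monom_degree_add keys_restrict_keys)
  qed
  moreover have "hom_part (c + d) (g * f)
      = hom_part (c + d) (g * hom_part d f) + hom_part (c + d) (g * ?r)"
    unfolding hom_part_def by (subst split[unfolded hom_part_def]) (rule restrict_keys_add)
  ultimately show ?thesis by simp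
qed

text \<open>Closure under components is required directly, instead of homogeneous generators, so
  that congruences modulo the ideal can be cut to a single degree.\<close>

definition homogeneous_ideal :: "nat set \<Rightarrow> 'k::field polynomial set \<Rightarrow> bool" where
  "homogeneous_ideal V I \<longleftrightarrow> I \<subseteq> poly_ring V \<and> 0 \<in> I \<and> (\<forall>f\<in>I. \<forall>g\<in>I. f + g \<in> I) \<and>
     (\<forall>r\<in>poly_ring V. \<forall>f\<in>I. r * f \<in> I) \<and> (\<forall>f\<in>I. \<forall>d. hom_part d f \<in> I)"

lemma homogeneous_idealD:
  assumes "homogeneous_ideal V I"
  shows "f \<in> I \<Longrightarrow> f \<in> poly_ring V" "0 \<in> I" "f \<in> I \<Longrightarrow> g \<in> I \<Longrightarrow> f + g \<in> I"
    "r \<in> poly_ring V \<Longrightarrow> f \<in> I \<Longrightarrow> r * f \<in> I" "f \<in> I \<Longrightarrow> hom_part d f \<in> I"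
    "f \<in> I \<Longrightarrow> - f \<in> I" "f \<in> I \<Longrightarrow> g \<in> I \<Longrightarrow> f - g \<in> I"
proof -
  have neg: "- f \<in> I" if "f \<in> I" for f
  proof -
    have "(- 1) * f \<in> I"
      using assms that poly_ring_uminus[OF poly_ring_one] unfolding homogeneous_ideal_def by blast
    then show ?thesis by simp
  qed
  show "f \<in> I \<Longrightarrow> - f \<in> I" by (rule neg)
  show "f \<in> I \<Longrightarrow> g \<in> I \<Longrightarrow> f - g \<in> I"
    using assms neg[of g] unfolding homogeneous_ideal_def by (metis diff_conv_add_uminus)
qed (use assms in \<open>auto simp: homogeneous_ideal_def\<close>)

lemma homogeneous_ideal_sum:
  assumes "homogeneous_ideal V I" "\<And>x. x \<in> A \<Longrightarrow> f x \<in> I"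
  shows "(\<Sum>x\<in>A. f x) \<in> I"
  using assms(2) by (induction A rule: infinite_finite_induct) (auto simp: homogeneous_idealD[OF assms(1)])

section \<open>Free modules and graded matrices over the polynomial ring\<close>

lemma free_module_carrier: "w \<in> free_module V r \<Longrightarrow> w \<in> carrier_vec r"
  by (simp add: free_module_def)

lemma free_module_add:
  "v \<in> free_module V r \<Longrightarrow> w \<in> free_module V r \<Longrightarrow> v + w \<in> free_module V r"
  by (auto simp: free_module_def poly_ring_add)

lemma free_module_diff:
  "v \<in> free_module V r \<Longrightarrow> w \<in> free_module V r \<Longrightarrow> v - w \<in> free_module V r"
  by (auto simp: free_module_def poly_ring_diff)

lemma free_module_uminus: "w \<in> free_module V r \<Longrightarrow> - w \<in> free_module V r"
  by (auto simp: free_module_def poly_ring_uminus)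

lemma free_module_unit: "a < r \<Longrightarrow> unit_vec r a \<in> free_module V r"
  by (auto simp: free_module_def unit_vec_def)

lemma free_module_scalar_prod:
  "v \<in> free_module V r \<Longrightarrow> w \<in> free_module V r \<Longrightarrow> v \<bullet> w \<in> poly_ring V"
  by (auto simp: free_module_def scalar_prod_def intro!: poly_ring_sum poly_ring_mult)

definition poly_mat :: "nat set \<Rightarrow> nat \<Rightarrow> nat \<Rightarrow> 'k::field polynomial mat set" where
  "poly_mat V r s = {A \<in> carrier_mat r s. \<forall>b<r. \<forall>a<s. A $$ (b, a) \<in> poly_ring V}"

lemma poly_mat_carrier: "A \<in> poly_mat V r s \<Longrightarrow> A \<in> carrier_mat r s"
  by (simp add: poly_mat_def)

lemma poly_mat_col: "A \<in> poly_mat V r s \<Longrightarrow> a < s \<Longrightarrow> col A a \<in> free_module V r"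
  by (auto simp: poly_mat_def free_module_def)

lemma poly_mat_row: "A \<in> poly_mat V r s \<Longrightarrow> b < r \<Longrightarrow> row A b \<in> free_module V s"
  by (auto simp: poly_mat_def free_module_def)

lemma poly_mat_mult_vec:
  assumes "A \<in> poly_mat V r s" "w \<in> free_module V s"
  shows "A *\<^sub>v w \<in> free_module V r"
  using assms free_module_scalar_prod[OF poly_mat_row[OF assms(1)] assms(2)]
  by (auto simp: free_module_def poly_mat_def)

lemma poly_mat_mult:
  assumes "A \<in> poly_mat V r s" "B \<in> poly_mat V s t"
  shows "A * B \<in> poly_mat V r t"
  using assms free_module_scalar_prod[OF poly_mat_row[OF assms(1)] poly_mat_col[OF assms(2)]]
  by (auto simp: poly_mat_def)

lemma poly_mat_diff: "A \<in> poly_mat V r s \<Longrightarrow> B \<in> poly_mat V r s \<Longrightarrow> A - B \<in> poly_mat V r s"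
  by (auto simp: poly_mat_def poly_ring_diff)

lemma poly_mat_zero: "0\<^sub>m r s \<in> poly_mat V r s"
  by (auto simp: poly_mat_def)

lemma poly_mat_one: "1\<^sub>m r \<in> poly_mat V r r"
  by (auto simp: poly_mat_def)

text \<open>These are the matrices of degree-preserving maps from the sum of the R(-a) to the sum of
  the R(-b), with a in \<open>as\<close> and b in \<open>bs\<close>.\<close>

definition homogeneous_mat :: "int list \<Rightarrow> int list \<Rightarrow> 'k::field polynomial mat \<Rightarrow> bool" where
  "homogeneous_mat bs as A \<longleftrightarrow>
     (\<forall>b<length bs. \<forall>a<length as. homogeneous (as ! a - bs ! b) (A $$ (b, a)))"

lemma homogeneous_mat_mult:
  assumes "homogeneous_mat cs bs A" "homogeneous_mat bs as B"
    "A \<in> carrier_mat (length cs) (length bs)" "B \<in> carrier_mat (length bs) (length as)"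
  shows "homogeneous_mat cs as (A * B)"
  unfolding homogeneous_mat_def
proof (intro allI impI)
  fix c a assume ca: "c < length cs" "a < length as"
  have "homogeneous (as ! a - cs ! c) (A $$ (c, b) * B $$ (b, a))" if "b < length bs" for b
    using homogeneous_mult[of "bs ! b - cs ! c" _ "as ! a - bs ! b"] assms(1,2) ca that
    by (fastforce simp: homogeneous_mat_def)
  then show "homogeneous (as ! a - cs ! c) ((A * B) $$ (c, a))"
    using ca assms(3,4) by (auto simp: scalar_prod_def intro!: homogeneous_sum)
qed

text \<open>This is projectivity of free modules in matrix form: preimages are chosen for the basis
  vectors and become the columns of the lift.\<close>

lemma lift_columns:
  assumes B: "B \<in> poly_mat V s t" and X: "X \<in> carrier_mat s q"
    and im: "\<And>l. l < q \<Longrightarrow> col X l \<in> (\<lambda>w. B *\<^sub>v w) ` free_module V t"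
  shows "\<exists>Y \<in> poly_mat V t q. B * Y = X"
proof -
  have "\<forall>l. \<exists>w. l < q \<longrightarrow> w \<in> free_module V t \<and> B *\<^sub>v w = col X l"
    using im by force
  then obtain y where y: "\<And>l. l < q \<Longrightarrow> y l \<in> free_module V t \<and> B *\<^sub>v y l = col X l"
    by metis
  define Y where "Y = mat t q (\<lambda>(i, l). y l $ i)"
  have colY: "col Y l = y l" if "l < q" for l
    using y[OF that] that by (intro eq_vecI) (auto simp: Y_def free_module_def)
  have Yc: "Y \<in> carrier_mat t q" by (simp add: Y_def)
  have "B * Y = X"
  proof (rule eq_matI)
    fix i l assume il: "i < dim_row X" "l < dim_col X"
    then have "(B * Y) $$ (i, l) = (B *\<^sub>v col Y l) $ i"
      using B Yc X by (auto simp: poly_mat_def)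
    also have "\<dots> = X $$ (i, l)" using il X y colY by auto
    finally show "(B * Y) $$ (i, l) = X $$ (i, l)" .
  qed (use B Yc X in \<open>auto simp: poly_mat_def\<close>)
  moreover have "Y \<in> poly_mat V t q"
    using y by (auto simp: poly_mat_def Y_def free_module_def)
  ultimately show ?thesis by blast
qed

text \<open>An ungraded lift is truncated entrywise to the prescribed degrees. As \<open>B\<close>
  and \<open>X\<close> are homogeneous, the discarded terms contribute only to degrees in which
  \<open>X\<close> vanishes.\<close>

lemma lift_columns_homogeneous:
  assumes B: "B \<in> poly_mat V (length bs) (length cs)" and X: "X \<in> carrier_mat (length bs) (length ds)"
    and hB: "homogeneous_mat bs cs B" and hX: "homogeneous_mat bs ds X"
    and im: "\<And>l. l < length ds \<Longrightarrow> col X l \<in> (\<lambda>w. B *\<^sub>v w) ` free_module V (length cs)"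
  shows "\<exists>Y \<in> poly_mat V (length cs) (length ds). homogeneous_mat cs ds Y \<and> B * Y = X"
proof -
  obtain Y where Y: "Y \<in> poly_mat V (length cs) (length ds)" and BY: "B * Y = X"
    using lift_columns[OF B X im] by blast
  define Z where "Z = mat (length cs) (length ds) (\<lambda>(j, l). hom_part (ds ! l - cs ! j) (Y $$ (j, l)))"
  have Z: "Z \<in> poly_mat V (length cs) (length ds)"
    using Y by (auto simp: Z_def poly_mat_def hom_part_def poly_ring_restrict_keys)
  have hZ: "homogeneous_mat cs ds Z"
    by (auto simp: homogeneous_mat_def Z_def homogeneous_hom_part)
  have "B * Z = X"
  proof (rule eq_matI)
    fix i l assume il: "i < dim_row X" "l < dim_col X"
    have il': "i < length bs" "l < length ds" using il X by auto
    have dims: "B \<in> carrier_mat (length bs) (length cs)" "Y \<in> carrier_mat (length cs) (length ds)"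
      "Z \<in> carrier_mat (length cs) (length ds)"
      using B Y Z by (auto simp: poly_mat_carrier)
    have sum: "X $$ (i, l) = (\<Sum>j<length cs. B $$ (i, j) * Y $$ (j, l))"
      using il' dims by (auto simp: BY[symmetric] scalar_prod_def atLeast0LessThan)
    have "X $$ (i, l) = hom_part (ds ! l - bs ! i) (X $$ (i, l))"
      using hX il' by (simp add: homogeneous_mat_def hom_part_id)
    also have "\<dots>
        = (\<Sum>j<length cs. hom_part (ds ! l - bs ! i) (B $$ (i, j) * Y $$ (j, l)))"
      unfolding hom_part_def sum by (rule restrict_keys_sum)
    also have "\<dots> = (\<Sum>j<length cs. B $$ (i, j) * Z $$ (j, l))"
    proof (rule sum.cong[OF refl])
      fix j assume "j \<in> {..<length cs}"
      then have "homogeneous (cs ! j - bs ! i) (B $$ (i, j))"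
        using hB il' by (simp add: homogeneous_mat_def)
      from hom_part_mult[OF this, of "ds ! l - cs ! j" "Y $$ (j, l)"]
      show "hom_part (ds ! l - bs ! i) (B $$ (i, j) * Y $$ (j, l)) = B $$ (i, j) * Z $$ (j, l)"
        using \<open>j \<in> _\<close> il' by (simp add: Z_def)
    qed
    also have "\<dots> = (B * Z) $$ (i, l)"
      using il' dims by (auto simp: scalar_prod_def atLeast0LessThan)
    finally show "(B * Z) $$ (i, l) = X $$ (i, l)" ..
  qed (use B Z X in \<open>auto simp: poly_mat_def\<close>)
  with Z hZ show ?thesis by blast
qed

section \<open>Uniqueness of graded Betti numbers\<close>

lemma scalar_prod_mult_mat_vec:
  fixes A :: "'a::comm_ring_1 mat"
  assumes "A \<in> carrier_mat r s" "v \<in> carrier_vec r" "w \<in> carrier_vec s"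
  shows "v \<bullet> (A *\<^sub>v w) = (\<Sum>a<s. (v \<bullet> col A a) * w $ a)"
proof -
  have "v \<bullet> (A *\<^sub>v w) = (\<Sum>b<r. \<Sum>a<s. v $ b * A $$ (b, a) * w $ a)"
    using assms by (auto simp: scalar_prod_def atLeast0LessThan sum_distrib_left mult.assoc)
  also have "\<dots> = (\<Sum>a<s. \<Sum>b<r. v $ b * A $$ (b, a) * w $ a)"
    by (rule sum.swap)
  also have "\<dots> = (\<Sum>a<s. (v \<bullet> col A a) * w $ a)"
    using assms by (auto simp: scalar_prod_def atLeast0LessThan sum_distrib_right)
  finally show ?thesis .
qed

lemma col_mult_mat: "A \<in> carrier_mat r s \<Longrightarrow> B \<in> carrier_mat s t \<Longrightarrow> l < t \<Longrightarrow> col (A * B) l = A *\<^sub>v col B l"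
  by (intro eq_vecI) auto

lemma mult_mat_unit_vec:
  fixes A :: "'a::comm_ring_1 mat"
  shows "A \<in> carrier_mat r s \<Longrightarrow> l < s \<Longrightarrow> A *\<^sub>v unit_vec s l = col A l"
  by (intro eq_vecI) auto

text \<open>The ideal property travels with the resolution because the definition of a resolution
  constrains only the maps.\<close>

locale graded_resolution =
  fixes V :: "nat set" and I :: "'k::field polynomial set" and ds e D
  assumes ideal: "homogeneous_ideal V I"
    and resolution: "minimal_graded_free_resolution V I ds e D"
begin

abbreviation F where "F i \<equiv> free_module V (length (ds i))"

text \<open>Merging the kernel of the augmentation to R/I with the kernels of the differentials
  turns exactness into one equation valid in all degrees.\<close>

definition cycles :: "nat \<Rightarrow> 'k polynomial vec set" where
  "cycles i = {w \<in> F i. case i of 0 \<Rightarrow> e \<bullet> w \<in> I | Suc l \<Rightarrow> D i *\<^sub>v w = 0\<^sub>v (length (ds l))}"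

lemma augmentation: "e \<in> F 0"
  and augmentation_homogeneous: "a < length (ds 0) \<Longrightarrow> homogeneous (ds 0 ! a) (e $ a)"
  and augmentation_surj: "f \<in> poly_ring V \<Longrightarrow> \<exists>w \<in> F 0. f - e \<bullet> w \<in> I"
  using resolution by (auto simp: minimal_graded_free_resolution_def)

lemma differential: "D (Suc i) \<in> poly_mat V (length (ds i)) (length (ds (Suc i)))"
  and differential_homogeneous: "homogeneous_mat (ds i) (ds (Suc i)) (D (Suc i))"
  and differential_minimal: "b < length (ds i) \<Longrightarrow> a < length (ds (Suc i)) \<Longrightarrow>
    Poly_Mapping.lookup (D (Suc i) $$ (b, a)) 0 = 0"
  using resolution by (auto simp: minimal_graded_free_resolution_def poly_mat_def homogeneous_mat_def)

lemma exact: "cycles i = (\<lambda>w. D (Suc i) *\<^sub>v w) ` F (Suc i)"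
  using resolution
  by (cases i) (auto simp: minimal_graded_free_resolution_def cycles_def Let_def)

lemma differential_carrier: "D (Suc i) \<in> carrier_mat (length (ds i)) (length (ds (Suc i)))"
  using differential by (rule poly_mat_carrier)

lemma differential_squared:
  "D (Suc i) * D (Suc (Suc i)) = 0\<^sub>m (length (ds i)) (length (ds (Suc (Suc i))))"
proof (rule eq_matI)
  fix b a assume ba: "b < dim_row (0\<^sub>m (length (ds i)) (length (ds (Suc (Suc i)))) :: 'k polynomial mat)"
    "a < dim_col (0\<^sub>m (length (ds i)) (length (ds (Suc (Suc i)))) :: 'k polynomial mat)"
  then have a: "a < length (ds (Suc (Suc i)))" and b: "b < length (ds i)" by auto
  have "D (Suc (Suc i)) *\<^sub>v unit_vec (length (ds (Suc (Suc i)))) a \<in> cycles (Suc i)"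
    unfolding exact by (intro imageI free_module_unit a)
  then have "D (Suc i) *\<^sub>v col (D (Suc (Suc i))) a = 0\<^sub>v (length (ds i))"
    using mult_mat_unit_vec[OF differential_carrier a] by (simp add: cycles_def)
  then have "(D (Suc i) *\<^sub>v col (D (Suc (Suc i))) a) $ b = 0" using b by simp
  then show "(D (Suc i) * D (Suc (Suc i))) $$ (b, a) = 0\<^sub>m (length (ds i)) (length (ds (Suc (Suc i)))) $$ (b, a)"
    using a b differential_carrier[of i] differential_carrier[of "Suc i"] by simp
qed (use differential_carrier[of i] differential_carrier[of "Suc i"] in auto)

text \<open>A chain map inducing zero on R/I is null-homotopic, X = D h' + h D. By minimality the
  entries of every differential lack constant terms, so the entries of \<open>X\<close> lack them
  too.\<close>

lemma null_homotopy_constant_terms: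
  assumes X: "\<And>i. X i \<in> poly_mat V (length (ds i)) (length (ds i))"
    and comm: "\<And>i. D (Suc i) * X (Suc i) = X i * D (Suc i)"
    and zero: "\<And>w. w \<in> F 0 \<Longrightarrow> e \<bullet> (X 0 *\<^sub>v w) \<in> I"
    and ba: "b < length (ds i)" "a < length (ds i)"
  shows "Poly_Mapping.lookup (X i $$ (b, a)) 0 = 0"
proof -
  let ?r = "\<lambda>i. length (ds i)"
  \<comment> \<open>The second conjunct says that the columns of
    \<open>X (Suc i) - h * D (Suc i)\<close> are cycles; by exactness they lift, and the lift is the
    next homotopy component.\<close>
  let ?P = "\<lambda>i h. h \<in> poly_mat V (?r (Suc i)) (?r i) \<and>
    D (Suc i) * (X (Suc i) - h * D (Suc i)) = 0\<^sub>m (?r i) (?r (Suc i))"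
  let ?Q = "\<lambda>i h h'. X (Suc i) = D (Suc (Suc i)) * h' + h * D (Suc i)"
  have step0: "\<exists>h. ?P 0 h \<and> X 0 = D 1 * h"
  proof -
    have "\<exists>h \<in> poly_mat V (?r 1) (?r 0). D 1 * h = X 0"
    proof (rule lift_columns)
      show "D 1 \<in> poly_mat V (?r 0) (?r 1)" using differential[of 0] by simp
      fix l assume l: "l < ?r 0"
      have "col (X 0) l \<in> cycles 0"
        using zero[OF free_module_unit[OF l]] poly_mat_col[OF X l]
          mult_mat_unit_vec[OF poly_mat_carrier[OF X[of 0]] l] l
        by (auto simp: cycles_def)
      then show "col (X 0) l \<in> (\<lambda>w. D 1 *\<^sub>v w) ` F 1" using exact[of 0] by simp
    qed (rule poly_mat_carrier[OF X])
    then obtain h where h: "h \<in> poly_mat V (?r 1) (?r 0)" "D 1 * h = X 0" by blast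
    have "D 1 * (X 1 - h * D 1) = D 1 * X 1 - (D 1 * h) * D 1"
      using differential_carrier[of 0] poly_mat_carrier[OF h(1)] poly_mat_carrier[OF X, of 1]
      by (subst mult_minus_distrib_mat[of _ "?r 0" "?r 1" _ "?r 1"])
        (auto simp: assoc_mult_mat[of _ "?r 0" "?r 1" _ "?r 0" _ "?r 1"])
    also have "\<dots> = 0\<^sub>m (?r 0) (?r 1)"
      using comm[of 0] h differential_carrier[of 0] poly_mat_carrier[OF X, of 0]
      by (intro eq_matI)
        (auto simp: carrier_matD[OF differential_carrier] carrier_matD[OF poly_mat_carrier[OF X]])
    finally show ?thesis using h by auto
  qed
  have step: "\<exists>h'. ?P (Suc i) h' \<and> ?Q i h h'" if h: "?P i h" for i h
  proof -
    have hc: "h \<in> carrier_mat (?r (Suc i)) (?r i)" using h by (auto simp: poly_mat_carrier)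
    note c = differential_carrier[of i] differential_carrier[of "Suc i"] poly_mat_carrier[OF X, of i]
      poly_mat_carrier[OF X, of "Suc i"] poly_mat_carrier[OF X, of "Suc (Suc i)"] hc
    let ?Y = "X (Suc i) - h * D (Suc i)"
    have Y: "?Y \<in> poly_mat V (?r (Suc i)) (?r (Suc i))"
      using h X differential by (intro poly_mat_diff poly_mat_mult) auto
    have "\<exists>h' \<in> poly_mat V (?r (Suc (Suc i))) (?r (Suc i)). D (Suc (Suc i)) * h' = ?Y"
    proof (rule lift_columns)
      fix l assume l: "l < ?r (Suc i)"
      have "D (Suc i) *\<^sub>v col ?Y l = col (D (Suc i) * ?Y) l"
        using col_mult_mat[OF c(1) poly_mat_carrier[OF Y] l] by simp
      also have "\<dots> = 0\<^sub>v (?r i)" using h l by auto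
      finally have "col ?Y l \<in> cycles (Suc i)"
        using poly_mat_col[OF Y l] by (simp add: cycles_def)
      then show "col ?Y l \<in> (\<lambda>w. D (Suc (Suc i)) *\<^sub>v w) ` F (Suc (Suc i))"
        using exact by blast
    qed (use differential Y in \<open>auto simp: poly_mat_carrier\<close>)
    then obtain h' where h': "h' \<in> poly_mat V (?r (Suc (Suc i))) (?r (Suc i))"
      "D (Suc (Suc i)) * h' = ?Y" by blast
    have h'c: "h' \<in> carrier_mat (?r (Suc (Suc i))) (?r (Suc i))" using h' by (auto simp: poly_mat_carrier)
    have "D (Suc (Suc i)) * (X (Suc (Suc i)) - h' * D (Suc (Suc i)))
        = D (Suc (Suc i)) * X (Suc (Suc i)) - ?Y * D (Suc (Suc i))"
      using c h'c h'(2) by (simp add: mult_minus_distrib_mat[OF c(2) c(5)]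
        flip: assoc_mult_mat[OF c(2) h'c c(2)])
    also have "?Y * D (Suc (Suc i)) = X (Suc i) * D (Suc (Suc i)) - h * D (Suc i) * D (Suc (Suc i))"
      by (rule minus_mult_distrib_mat[OF c(4) mult_carrier_mat[OF hc c(1)] c(2)])
    also have "h * D (Suc i) * D (Suc (Suc i)) = 0\<^sub>m (?r (Suc i)) (?r (Suc (Suc i)))"
      using c by (simp add: assoc_mult_mat[OF hc c(1) c(2)] differential_squared)
    also have "D (Suc (Suc i)) * X (Suc (Suc i)) - (X (Suc i) * D (Suc (Suc i)) - 0\<^sub>m (?r (Suc i)) (?r (Suc (Suc i))))
        = 0\<^sub>m (?r (Suc i)) (?r (Suc (Suc i)))"
      using comm[of "Suc i"] c by auto
    finally have "?P (Suc i) h'" using h' by simp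
    moreover have "?Q i h h'" unfolding h'(2) using c by auto
    ultimately show ?thesis by blast
  qed
  have const0: "Poly_Mapping.lookup ((A * B) $$ (b, a)) 0 = 0"
    if "A \<in> carrier_mat r s" "B \<in> carrier_mat s t" "b < r" "a < t"
      "\<And>c. c < s \<Longrightarrow> Poly_Mapping.lookup (A $$ (b, c)) 0 = 0 \<or> Poly_Mapping.lookup (B $$ (c, a)) 0 = 0"
    for A B :: "'k polynomial mat" and r s t b a
    using that by (auto simp: scalar_prod_def lookup_sum lookup_0_mult intro!: sum.neutral)
  obtain h0 where h0: "?P 0 h0" "X 0 = D 1 * h0" using step0 by blast
  \<comment> \<open>Each component depends on its predecessor, hence dependent choice. The clause
    for \<open>n = 0\<close> retains the equation for \<open>X 0\<close>, to which no earlier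
    component contributes.\<close>
  have "\<exists>h. \<forall>n. (?P n (h n) \<and> (n = 0 \<longrightarrow> X 0 = D 1 * h n)) \<and> ?Q n (h n) (h (Suc n))"
    by (rule dependent_nat_choice) (use h0 step in blast)+
  then obtain h where P: "\<And>n. ?P n (h n)" and X0: "X 0 = D 1 * h 0" and Q: "\<And>n. ?Q n (h n) (h (Suc n))"
    by blast
  have hc: "h n \<in> carrier_mat (?r (Suc n)) (?r n)" for n using P[of n] poly_mat_carrier by blast
  show ?thesis
  proof (cases i)
    case 0
    then show ?thesis unfolding 0 X0 using ba 0 differential_minimal[of _ 0] differential_carrier[of 0] hc[of 0]
      by (intro const0[of _ "?r 0" "?r 1" _ "?r 0"]) auto
  next
    case (Suc n)
    have "Poly_Mapping.lookup ((D (Suc (Suc n)) * h (Suc n)) $$ (b, a)) 0 = 0"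
      using ba Suc differential_minimal differential_carrier[of "Suc n"] hc[of "Suc n"]
      by (intro const0[of _ "?r (Suc n)" "?r (Suc (Suc n))" _ "?r (Suc n)"]) auto
    moreover have "Poly_Mapping.lookup ((h n * D (Suc n)) $$ (b, a)) 0 = 0"
      using ba Suc differential_minimal differential_carrier[of n] hc[of n]
      by (intro const0[of _ "?r (Suc n)" "?r n" _ "?r (Suc n)"]) auto
    ultimately show ?thesis
      unfolding Suc Q[of n] using ba Suc differential_carrier[of "Suc n"] hc[of "Suc n"] differential_carrier[of n] hc[of n]
      by (simp add: lookup_add)
  qed
qed

end

section \<open>Comparison maps over multiplication by a homogeneous element\<close>

lemma lift_augmentation:
  assumes F: "graded_resolution V I ds e D" and G: "graded_resolution V J es e' E"
    and m: "m \<in> poly_ring V" "homogeneous c m"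
  shows "\<exists>\<Phi> \<in> poly_mat V (length (es 0)) (length (ds 0)).
    homogeneous_mat (es 0) (map (\<lambda>d. d + c) (ds 0)) \<Phi> \<and>
    (\<forall>w \<in> free_module V (length (ds 0)). e' \<bullet> (\<Phi> *\<^sub>v w) - m * (e \<bullet> w) \<in> J)"
proof -
  interpret F: graded_resolution V I ds e D by (rule F)
  interpret G: graded_resolution V J es e' E by (rule G)
  let ?r = "length (ds 0)" and ?s = "length (es 0)"
  have e_poly: "e $ a \<in> poly_ring V" if "a < ?r" for a
    using F.augmentation that by (simp add: free_module_def)
  have "\<forall>a. \<exists>y. a < ?r \<longrightarrow> y \<in> free_module V ?s \<and> m * e $ a - e' \<bullet> y \<in> J"
    using G.augmentation_surj poly_ring_mult[OF m(1) e_poly] by blast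
  then obtain y where y: "\<And>a. a < ?r \<Longrightarrow> y a \<in> free_module V ?s \<and> m * e $ a - e' \<bullet> y a \<in> J"
    by metis
  \<comment> \<open>The preimages \<open>y a\<close> need not be homogeneous, so each is cut to the
    degree of \<open>m * e $ a\<close>. The congruence survives because \<open>J\<close> contains
    the components of its elements.\<close>
  define \<Phi> where "\<Phi> = mat ?s ?r (\<lambda>(b, a). hom_part (ds 0 ! a + c - es 0 ! b) (y a $ b))"
  have \<Phi>: "\<Phi> \<in> poly_mat V ?s ?r"
    using y by (auto simp: \<Phi>_def poly_mat_def free_module_def hom_part_def poly_ring_restrict_keys)
  have col: "e' \<bullet> col \<Phi> a - m * e $ a \<in> J" if a: "a < ?r" for a
  proof -
    let ?d = "ds 0 ! a + c"
    have "e' \<bullet> col \<Phi> a = (\<Sum>b<?s. e' $ b * hom_part (?d - es 0 ! b) (y a $ b))"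
      using a by (auto simp: scalar_prod_def \<Phi>_def atLeast0LessThan)
    also have "\<dots> = (\<Sum>b<?s. hom_part ?d (e' $ b * y a $ b))"
    proof (rule sum.cong[OF refl])
      fix b assume "b \<in> {..<?s}"
      then show "e' $ b * hom_part (?d - es 0 ! b) (y a $ b) = hom_part ?d (e' $ b * y a $ b)"
        using hom_part_mult[OF G.augmentation_homogeneous, of b "?d - es 0 ! b" "y a $ b"] by simp
    qed
    also have "\<dots> = hom_part ?d (e' \<bullet> y a)"
      using y[OF a] by (auto simp: hom_part_def restrict_keys_sum scalar_prod_def free_module_def atLeast0LessThan)
    finally have 1: "e' \<bullet> col \<Phi> a = hom_part ?d (e' \<bullet> y a)" .
    have 2: "m * e $ a = hom_part ?d (m * e $ a)"
      using homogeneous_mult[OF F.augmentation_homogeneous[OF a] m(2)]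
      by (intro hom_part_id[symmetric]) (simp add: mult.commute)
    have "hom_part ?d (m * e $ a) - hom_part ?d (e' \<bullet> y a) = hom_part ?d (m * e $ a - e' \<bullet> y a)"
      by (simp add: hom_part_def restrict_keys_diff)
    then have "m * e $ a - e' \<bullet> col \<Phi> a \<in> J"
      using homogeneous_idealD(5)[OF G.ideal] y[OF a] unfolding 1 2[symmetric] using 2 by metis
    then show ?thesis using homogeneous_idealD(6)[OF G.ideal] by fastforce
  qed
  have "e' \<bullet> (\<Phi> *\<^sub>v w) - m * (e \<bullet> w) \<in> J" if w: "w \<in> free_module V ?r" for w
  proof -
    have "e' \<bullet> (\<Phi> *\<^sub>v w) = (\<Sum>a<?r. (e' \<bullet> col \<Phi> a) * w $ a)"
      using poly_mat_carrier[OF \<Phi>] free_module_carrier[OF G.augmentation] free_module_carrier[OF w]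
      by (rule scalar_prod_mult_mat_vec)
    moreover have "m * (e \<bullet> w) = (\<Sum>a<?r. m * e $ a * w $ a)"
      using w by (auto simp: scalar_prod_def free_module_def sum_distrib_left atLeast0LessThan mult.assoc)
    ultimately have "e' \<bullet> (\<Phi> *\<^sub>v w) - m * (e \<bullet> w) = (\<Sum>a<?r. w $ a * (e' \<bullet> col \<Phi> a - m * e $ a))"
      by (simp add: sum_subtractf algebra_simps)
    also have "\<dots> \<in> J"
      using w col by (intro homogeneous_ideal_sum[OF G.ideal] homogeneous_idealD(4)[OF G.ideal])
        (auto simp: free_module_def)
    finally show ?thesis .
  qed
  moreover have "homogeneous_mat (es 0) (map (\<lambda>d. d + c) (ds 0)) \<Phi>"
    by (auto simp: homogeneous_mat_def \<Phi>_def homogeneous_hom_part)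
  ultimately show ?thesis using \<Phi> by blast
qed

text \<open>The comparison theorem: multiplication by \<open>m\<close> descends to a map from R/I to
  R/J and lifts step by step, with all degrees shifted by \<open>c\<close>. Allowing a general
  \<open>m\<close> serves both the uniqueness proof and the mapping cone.\<close>

lemma chain_map_exists:
  assumes F: "graded_resolution V I ds e D" and G: "graded_resolution V J es e' E"
    and m: "m \<in> poly_ring V" "homogeneous c m" and mI: "\<And>f. f \<in> I \<Longrightarrow> m * f \<in> J"
  obtains \<Phi> where "\<And>i. \<Phi> i \<in> poly_mat V (length (es i)) (length (ds i))"
    "\<And>i. homogeneous_mat (es i) (map (\<lambda>d. d + c) (ds i)) (\<Phi> i)"
    "\<And>w. w \<in> free_module V (length (ds 0)) \<Longrightarrow> e' \<bullet> (\<Phi> 0 *\<^sub>v w) - m * (e \<bullet> w) \<in> J"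
    "\<And>i. E (Suc i) * \<Phi> (Suc i) = \<Phi> i * D (Suc i)"
proof -
  interpret F: graded_resolution V I ds e D by (rule F)
  interpret G: graded_resolution V J es e' E by (rule G)
  let ?r = "\<lambda>i. length (ds i)" and ?s = "\<lambda>i. length (es i)"
  let ?sh = "\<lambda>i. map (\<lambda>d. d + c) (ds i)"
  \<comment> \<open>The invariant keeps just what the next lift uses: the composite with the next
    differential lands in cycles, and cycles are images by exactness.\<close>
  let ?P = "\<lambda>i \<phi>. \<phi> \<in> poly_mat V (?s i) (?r i) \<and> homogeneous_mat (es i) (?sh i) \<phi> \<and>
    (\<forall>w\<in>F.F (Suc i). \<phi> *\<^sub>v (D (Suc i) *\<^sub>v w) \<in> G.cycles i)"
  let ?Z = "\<lambda>\<phi>. \<forall>w \<in> free_module V (?r 0). e' \<bullet> (\<phi> *\<^sub>v w) - m * (e \<bullet> w) \<in> J"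
  let ?Q = "\<lambda>i \<phi> \<phi>'. E (Suc i) * \<phi>' = \<phi> * D (Suc i)"
  have base: "\<exists>\<phi>. ?P 0 \<phi> \<and> ?Z \<phi>"
  proof -
    obtain \<phi> where \<phi>: "\<phi> \<in> poly_mat V (?s 0) (?r 0)" "homogeneous_mat (es 0) (?sh 0) \<phi>" "?Z \<phi>"
      using lift_augmentation[OF F G m] by blast
    have "\<phi> *\<^sub>v (D 1 *\<^sub>v w) \<in> G.cycles 0" if w: "w \<in> F.F 1" for w
    proof -
      have Dw: "D 1 *\<^sub>v w \<in> F.cycles 0" using F.exact[of 0] w by simp
      then have "m * (e \<bullet> (D 1 *\<^sub>v w)) \<in> J" "D 1 *\<^sub>v w \<in> F.F 0"
        using mI by (auto simp: F.cycles_def)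
      then have "e' \<bullet> (\<phi> *\<^sub>v (D 1 *\<^sub>v w)) - m * (e \<bullet> (D 1 *\<^sub>v w)) + m * (e \<bullet> (D 1 *\<^sub>v w)) \<in> J"
        using \<phi>(3) homogeneous_idealD(3)[OF G.ideal] by blast
      then show ?thesis
        using poly_mat_mult_vec[OF \<phi>(1)] \<open>D 1 *\<^sub>v w \<in> F.F 0\<close> by (simp add: G.cycles_def)
    qed
    with \<phi> show ?thesis by auto
  qed
  have step: "\<exists>\<phi>'. ?P (Suc i) \<phi>' \<and> ?Q i \<phi> \<phi>'" if \<phi>: "?P i \<phi>" for i \<phi>
  proof -
    have c: "\<phi> \<in> carrier_mat (?s i) (?r i)" using \<phi> by (auto simp: poly_mat_carrier)
    have \<phi>D: "\<phi> * D (Suc i) \<in> poly_mat V (?s i) (?r (Suc i))"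
      using \<phi> F.differential by (auto intro: poly_mat_mult)
    have "homogeneous_mat (?sh i) (?sh (Suc i)) (D (Suc i))"
      using F.differential_homogeneous[of i] by (simp add: homogeneous_mat_def)
    then have h\<phi>D: "homogeneous_mat (es i) (?sh (Suc i)) (\<phi> * D (Suc i))"
      using \<phi> c F.differential_carrier[of i] by (intro homogeneous_mat_mult[of _ "?sh i"]) auto
    have "\<exists>\<phi>' \<in> poly_mat V (length (es (Suc i))) (length (?sh (Suc i))).
        homogeneous_mat (es (Suc i)) (?sh (Suc i)) \<phi>' \<and> E (Suc i) * \<phi>' = \<phi> * D (Suc i)"
    proof (rule lift_columns_homogeneous[OF G.differential _ G.differential_homogeneous h\<phi>D])
      fix l assume "l < length (?sh (Suc i))"
      then have l: "l < ?r (Suc i)" by simp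
      have "col (\<phi> * D (Suc i)) l = \<phi> *\<^sub>v (D (Suc i) *\<^sub>v unit_vec (?r (Suc i)) l)"
        using l c F.differential_carrier[of i] by (simp add: col_mult_mat[of _ "?s i" "?r i"] mult_mat_unit_vec)
      also have "\<dots> \<in> G.cycles i" using \<phi> free_module_unit[OF l] by blast
      finally show "col (\<phi> * D (Suc i)) l \<in> (\<lambda>w. E (Suc i) *\<^sub>v w) ` G.F (Suc i)"
        by (simp add: G.exact)
    qed (use \<phi>D in \<open>auto simp: poly_mat_carrier\<close>)
    then obtain \<phi>' where \<phi>': "\<phi>' \<in> poly_mat V (?s (Suc i)) (?r (Suc i))"
      "homogeneous_mat (es (Suc i)) (?sh (Suc i)) \<phi>'" "E (Suc i) * \<phi>' = \<phi> * D (Suc i)" by auto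
    have "\<phi>' *\<^sub>v (D (Suc (Suc i)) *\<^sub>v w) \<in> G.cycles (Suc i)" if w: "w \<in> F.F (Suc (Suc i))" for w
    proof -
      let ?v = "D (Suc (Suc i)) *\<^sub>v w"
      have v: "?v \<in> F.F (Suc i)" "D (Suc i) *\<^sub>v ?v = 0\<^sub>v (?r i)"
        using F.exact[of "Suc i"] w by (auto simp: F.cycles_def)
      note cs = G.differential_carrier[of i] poly_mat_carrier[OF \<phi>'(1)] free_module_carrier[OF v(1)]
      have "E (Suc i) *\<^sub>v (\<phi>' *\<^sub>v ?v) = (\<phi> * D (Suc i)) *\<^sub>v ?v"
        using cs by (simp add: \<phi>'(3)[symmetric])
      also have "\<dots> = 0\<^sub>v (?s i)"
        using c F.differential_carrier[of i] free_module_carrier[OF v(1)] v(2) by auto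
      finally show ?thesis using poly_mat_mult_vec[OF \<phi>'(1) v(1)] by (simp add: G.cycles_def)
    qed
    with \<phi>' show ?thesis by blast
  qed
  obtain \<phi>0 where \<phi>0: "?P 0 \<phi>0 \<and> ?Z \<phi>0" using base by blast
  have "\<exists>\<Phi>. \<forall>n. (?P n (\<Phi> n) \<and> (n = 0 \<longrightarrow> ?Z (\<Phi> n))) \<and> ?Q n (\<Phi> n) (\<Phi> (Suc n))"
  proof (rule dependent_nat_choice)
    show "\<exists>\<phi>. ?P 0 \<phi> \<and> (0 = (0 :: nat) \<longrightarrow> ?Z \<phi>)"
      using \<phi>0 by blast
  next
    fix \<phi> n assume "?P n \<phi> \<and> (n = 0 \<longrightarrow> ?Z \<phi>)"
    then obtain \<phi>' where "?P (Suc n) \<phi>' \<and> ?Q n \<phi> \<phi>'"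
      using step[of \<phi> n] by blast
    moreover have "Suc n \<noteq> 0" by simp
    ultimately show "\<exists>\<phi>'. (?P (Suc n) \<phi>' \<and> (Suc n = 0 \<longrightarrow> ?Z \<phi>')) \<and> ?Q n \<phi> \<phi>'"
      by (intro exI[of _ \<phi>']) blast
  qed
  then show ?thesis using that by blast
qed

text \<open>If \<open>T\<close> were smaller, padding both matrices with zeros to size
  \<open>card S\<close> would give square matrices with P Q = 1, hence Q P = 1. But the last row of
  Q is padding, so Q P has a zero row.\<close>

lemma card_le_of_left_inverse:
  fixes f :: "'a \<Rightarrow> 'b \<Rightarrow> 'k::field"
  assumes "finite S" "finite T"
    and inv: "\<And>a a'. a \<in> S \<Longrightarrow> a' \<in> S \<Longrightarrow> (\<Sum>b\<in>T. f a b * g b a') = (if a = a' then 1 else 0)"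
  shows "card S \<le> card T"
proof (rule ccontr)
  assume less: "\<not> card S \<le> card T"
  let ?n = "card S" and ?m = "card T"
  obtain h where h: "bij_betw h {..<?n} S"
    using ex_bij_betw_nat_finite[OF assms(1)] atLeast0LessThan by metis
  obtain k where k: "bij_betw k {..<?m} T"
    using ex_bij_betw_nat_finite[OF assms(2)] atLeast0LessThan by metis
  define P where "P = mat ?n ?n (\<lambda>(i, j). if j < ?m then f (h i) (k j) else 0)"
  define Q where "Q = mat ?n ?n (\<lambda>(i, j). if i < ?m then g (k i) (h j) else 0)"
  have carrier: "P \<in> carrier_mat ?n ?n" "Q \<in> carrier_mat ?n ?n"
    by (simp_all add: P_def Q_def)
  have "P * Q = 1\<^sub>m ?n"
  proof (rule eq_matI)
    fix i j assume ij: "i < dim_row (1\<^sub>m ?n :: 'k mat)" "j < dim_col (1\<^sub>m ?n :: 'k mat)"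
    then have "(P * Q) $$ (i, j) = (\<Sum>l<?n. if l < ?m then f (h i) (k l) * g (k l) (h j) else 0)"
      by (auto simp: P_def Q_def scalar_prod_def atLeast0LessThan intro!: sum.cong)
    also have "\<dots> = (\<Sum>l<?m. f (h i) (k l) * g (k l) (h j))"
      using less by (intro sum.mono_neutral_cong_right) auto
    also have "\<dots> = (\<Sum>b\<in>T. f (h i) b * g b (h j))"
      using sum.reindex_bij_betw[OF k] by fast
    also have "\<dots> = (if h i = h j then 1 else 0)"
      using ij h by (intro inv) (auto simp: bij_betw_def)
    also have "\<dots> = 1\<^sub>m ?n $$ (i, j)"
      using ij h by (auto simp: bij_betw_def inj_on_def)
    finally show "(P * Q) $$ (i, j) = 1\<^sub>m ?n $$ (i, j)" .
  qed (auto simp: P_def Q_def)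
  then have QP: "Q * P = 1\<^sub>m ?n"
    by (rule mat_mult_left_right_inverse[OF carrier])
  have "(Q * P) $$ (?n - 1, ?n - 1) = 0"
  proof -
    have "(Q * P) $$ (?n - 1, ?n - 1) = (\<Sum>l<?n. Q $$ (?n - 1, l) * P $$ (l, ?n - 1))"
      using less by (simp add: P_def Q_def scalar_prod_def atLeast0LessThan)
    also have "\<dots> = 0"
      using less by (intro sum.neutral) (force simp: Q_def)
    finally show ?thesis .
  qed
  then show False using less unfolding QP by simp
qed

text \<open>The composite of the comparison maps in the two directions differs from the identity by
  a map inducing zero on R/I, so its constant terms form an identity matrix. Constant terms of
  homogeneous matrices only link generators of equal degree, so this left inverse restricts to
  degree \<open>j\<close>.\<close>

lemma minimal_resolution_count_le:
  assumes F: "graded_resolution V I ds e D" and G: "graded_resolution V I es e' E"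
  shows "count_list (ds i) j \<le> count_list (es i) j"
proof -
  interpret F: graded_resolution V I ds e D by (rule F)
  interpret G: graded_resolution V I es e' E by (rule G)
  let ?r = "\<lambda>i. length (ds i)" and ?s = "\<lambda>i. length (es i)"
  obtain \<Phi> where \<Phi>: "\<And>i. \<Phi> i \<in> poly_mat V (?s i) (?r i)"
    "\<And>i. homogeneous_mat (es i) (map (\<lambda>d. d + 0) (ds i)) (\<Phi> i)"
    "\<And>w. w \<in> F.F 0 \<Longrightarrow> e' \<bullet> (\<Phi> 0 *\<^sub>v w) - 1 * (e \<bullet> w) \<in> I"
    "\<And>i. E (Suc i) * \<Phi> (Suc i) = \<Phi> i * D (Suc i)"
    by (rule chain_map_exists[OF F G, of 1 0]) auto
  obtain \<Psi> where \<Psi>: "\<And>i. \<Psi> i \<in> poly_mat V (?r i) (?s i)"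
    "\<And>i. homogeneous_mat (ds i) (map (\<lambda>d. d + 0) (es i)) (\<Psi> i)"
    "\<And>w. w \<in> G.F 0 \<Longrightarrow> e \<bullet> (\<Psi> 0 *\<^sub>v w) - 1 * (e' \<bullet> w) \<in> I"
    "\<And>i. D (Suc i) * \<Psi> (Suc i) = \<Psi> i * E (Suc i)"
    by (rule chain_map_exists[OF G F, of 1 0]) auto
  note c\<Phi> = poly_mat_carrier[OF \<Phi>(1)] and c\<Psi> = poly_mat_carrier[OF \<Psi>(1)]
  note cD = F.differential_carrier and cE = G.differential_carrier
  define X where "X i = \<Psi> i * \<Phi> i - 1\<^sub>m (?r i)" for i
  have const: "Poly_Mapping.lookup (X i $$ (b, a)) 0 = 0" if "b < ?r i" "a < ?r i" for b a
  proof (rule F.null_homotopy_constant_terms[OF _ _ _ that])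
    show "X i \<in> poly_mat V (?r i) (?r i)" for i
      unfolding X_def using \<Phi>(1) \<Psi>(1) by (intro poly_mat_diff poly_mat_mult poly_mat_one)
    show "D (Suc i) * X (Suc i) = X i * D (Suc i)" for i
    proof -
      have "D (Suc i) * X (Suc i) = D (Suc i) * (\<Psi> (Suc i) * \<Phi> (Suc i)) - D (Suc i)"
        unfolding X_def using cD[of i] c\<Phi>[of "Suc i"] c\<Psi>[of "Suc i"]
        by (subst mult_minus_distrib_mat[OF cD]) auto
      also have "D (Suc i) * (\<Psi> (Suc i) * \<Phi> (Suc i)) = \<Psi> i * (E (Suc i) * \<Phi> (Suc i))"
        by (simp add: \<Psi>(4) assoc_mult_mat[OF c\<Psi> cE c\<Phi>] flip: assoc_mult_mat[OF cD c\<Psi> c\<Phi>])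
      also have "\<dots> = (\<Psi> i * \<Phi> i) * D (Suc i)"
        by (simp add: \<Phi>(4) assoc_mult_mat[OF c\<Psi> c\<Phi> cD])
      also have "\<dots> - D (Suc i) = X i * D (Suc i)"
        unfolding X_def using cD[of i] c\<Phi>[of i] c\<Psi>[of i]
        by (subst minus_mult_distrib_mat[of _ "?r i" "?r i"]) auto
      finally show ?thesis .
    qed
    show "e \<bullet> (X 0 *\<^sub>v w) \<in> I" if w: "w \<in> F.F 0" for w
    proof -
      have wc: "w \<in> carrier_vec (?r 0)" using w by (rule free_module_carrier)
      have "X 0 *\<^sub>v w = \<Psi> 0 *\<^sub>v (\<Phi> 0 *\<^sub>v w) - w"
        unfolding X_def using c\<Phi>[of 0] c\<Psi>[of 0] wc
        by (subst minus_mult_distrib_mat_vec[of _ "?r 0" "?r 0"]) auto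
      then have "e \<bullet> (X 0 *\<^sub>v w) = e \<bullet> (\<Psi> 0 *\<^sub>v (\<Phi> 0 *\<^sub>v w)) - e \<bullet> w"
        using c\<Phi>[of 0] c\<Psi>[of 0] wc free_module_carrier[OF F.augmentation]
        by (simp add: scalar_prod_minus_distrib[of _ "?r 0"])
      also have "\<dots> = (e \<bullet> (\<Psi> 0 *\<^sub>v (\<Phi> 0 *\<^sub>v w)) - 1 * (e' \<bullet> (\<Phi> 0 *\<^sub>v w))) + (e' \<bullet> (\<Phi> 0 *\<^sub>v w) - 1 * (e \<bullet> w))"
        by simp
      also have "\<dots> \<in> I"
        using \<Phi>(3)[OF w] \<Psi>(3)[OF poly_mat_mult_vec[OF \<Phi>(1) w]] by (rule homogeneous_idealD(3)[OF F.ideal, rotated])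
      finally show ?thesis .
    qed
  qed
  let ?f = "\<lambda>a b. Poly_Mapping.lookup (\<Psi> i $$ (a, b)) 0"
  let ?g = "\<lambda>b a. Poly_Mapping.lookup (\<Phi> i $$ (b, a)) 0"
  have inv: "(\<Sum>b<?s i. ?f a b * ?g b a') = (if a = a' then 1 else 0)" if "a < ?r i" "a' < ?r i" for a a'
  proof -
    have "(\<Sum>b<?s i. ?f a b * ?g b a') = Poly_Mapping.lookup ((\<Psi> i * \<Phi> i) $$ (a, a')) 0"
      using that c\<Phi>[of i] c\<Psi>[of i]
      by (auto simp: scalar_prod_def lookup_sum lookup_0_mult atLeast0LessThan)
    also have "(\<Psi> i * \<Phi> i) $$ (a, a') = X i $$ (a, a') + 1\<^sub>m (?r i) $$ (a, a')"
      using that c\<Phi>[of i] c\<Psi>[of i] by (simp add: X_def)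
    also have "Poly_Mapping.lookup \<dots> 0 = (if a = a' then 1 else 0)"
      using const[OF that] that by (auto simp: lookup_add)
    finally show ?thesis .
  qed
  have "card {a. a < ?r i \<and> ds i ! a = j} \<le> card {b. b < ?s i \<and> es i ! b = j}"
  proof (rule card_le_of_left_inverse[of _ _ ?f ?g])
    fix a a' assume a: "a \<in> {a. a < ?r i \<and> ds i ! a = j}" "a' \<in> {a. a < ?r i \<and> ds i ! a = j}"
    \<comment> \<open>Generators of degree other than \<open>j\<close> drop out: there the entry of
      \<open>\<Phi> i\<close> has nonzero degree and thus no constant term.\<close>
    have "(\<Sum>b | b < ?s i \<and> es i ! b = j. ?f a b * ?g b a') = (\<Sum>b<?s i. ?f a b * ?g b a')"
    proof (rule sum.mono_neutral_left)
      show "\<forall>b\<in>{..<?s i} - {b. b < ?s i \<and> es i ! b = j}. ?f a b * ?g b a' = 0"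
      proof
        fix b assume b: "b \<in> {..<?s i} - {b. b < ?s i \<and> es i ! b = j}"
        have "homogeneous (ds i ! a' - es i ! b) (\<Phi> i $$ (b, a'))"
          using \<Phi>(2)[of i, unfolded homogeneous_mat_def, simplified] a b by blast
        then show "?f a b * ?g b a' = 0" using a b homogeneous_lookup_0 by force
      qed
    qed auto
    then show "(\<Sum>b | b < ?s i \<and> es i ! b = j. ?f a b * ?g b a') = (if a = a' then 1 else 0)"
      using inv a by simp
  qed auto
  then show ?thesis
    by (simp add: count_list_eq_length_filter length_filter_conv_card eq_commute[of j])
qed

lemma graded_betti_eq:
  assumes "graded_resolution V I ds e D"
  shows "graded_betti V I i j = count_list (ds i) j"
  unfolding graded_betti_def
proof (rule the_equality)
  show "\<exists>ds' e D. minimal_graded_free_resolution V I ds' e D \<and> count_list (ds i) j = count_list (ds' i) j"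
    using graded_resolution.resolution[OF assms] by blast
next
  fix b assume "\<exists>ds e D. minimal_graded_free_resolution V I ds e D \<and> b = count_list (ds i) j"
  then obtain ds' e' D' where res: "graded_resolution V I ds' e' D'" and b: "b = count_list (ds' i) j"
    using graded_resolution.ideal[OF assms] by (auto simp: graded_resolution_def)
  show "b = count_list (ds i) j"
    unfolding b using minimal_resolution_count_le[OF res assms] minimal_resolution_count_le[OF assms res]
    by (rule antisym)
qed

section \<open>Mapping cones\<close>

lemma mult_mat_vec_uminus:
  fixes A :: "'a::comm_ring_1 mat"
  assumes "A \<in> carrier_mat r s" "w \<in> carrier_vec s"
  shows "A *\<^sub>v (- w) = - (A *\<^sub>v w)"
  using assms by (intro eq_vecI) auto

lemma free_module_append:
  "f \<in> free_module V r \<Longrightarrow> g \<in> free_module V s \<Longrightarrow> f @\<^sub>v g \<in> free_module V (r + s)"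
  by (auto simp: free_module_def append_vec_def)

lemma free_module_appendE:
  assumes "w \<in> free_module V (r + s)"
  obtains f g where "w = f @\<^sub>v g" "f \<in> free_module V r" "g \<in> free_module V s"
proof
  show "w = vec_first w r @\<^sub>v vec_last w s"
    using assms by (simp add: free_module_def)
qed (use assms in \<open>auto simp: free_module_def vec_first_def vec_last_def\<close>)

text \<open>In a mapping cone the second resolution sits one homological degree higher, twisted by
  the degree of the multiplier. Nothing is added in degree 0, so the augmentation of the first
  resolution serves for the cone.\<close>

definition shifted :: "int \<Rightarrow> (nat \<Rightarrow> int list) \<Rightarrow> nat \<Rightarrow> int list" where
  "shifted d es i = (case i of 0 \<Rightarrow> [] | Suc j \<Rightarrow> map (\<lambda>x. x + d) (es j))"

lemma shifted_simps [simp]: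
  "shifted d es 0 = []" "shifted d es (Suc j) = map (\<lambda>x. x + d) (es j)"
  by (simp_all add: shifted_def)

text \<open>The minus sign in the lower right block makes consecutive differentials compose to zero. If
  multiplication by \<open>m\<close> lifts to a map of resolutions without constant terms, the cone of this map
  is again minimal; here this is forced by the degrees.\<close>

lemma mapping_cone:
  assumes F: "graded_resolution V I ds e D" and G: "graded_resolution V J es e' E"
    and K: "homogeneous_ideal V K"
    and m: "m \<in> poly_ring V" "homogeneous d m"
    and IK: "I \<subseteq> K" and mK: "\<And>g. g \<in> poly_ring V \<Longrightarrow> m * g \<in> K"
    and split: "\<And>f. f \<in> K \<Longrightarrow> \<exists>g \<in> poly_ring V. f - m * g \<in> I"
    and colon: "\<And>g. g \<in> poly_ring V \<Longrightarrow> g \<in> J \<longleftrightarrow> m * g \<in> I"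
    and deg: "\<And>i a b. a \<in> set (ds i) \<Longrightarrow> b \<in> set (es i) \<Longrightarrow> a \<noteq> b + d"
  shows "\<exists>C. graded_resolution V K (\<lambda>i. ds i @ shifted d es i) e C"
proof -
  interpret F: graded_resolution V I ds e D by (rule F)
  interpret G: graded_resolution V J es e' E by (rule G)
  let ?r = "\<lambda>i. length (ds i)" and ?s = "\<lambda>i. length (es i)"
  define l where "l i = length (shifted d es i)" for i
  have l_simps [simp]: "l 0 = 0" "l (Suc i) = ?s i" for i by (simp_all add: l_def)
  \<comment> \<open>One direction of \<open>colon\<close> makes multiplication by \<open>m\<close> a
    well-defined map from R/J to R/I, which can then be lifted.\<close>
  have "m * f \<in> I" if "f \<in> J" for f
    using colon homogeneous_idealD(1)[OF G.ideal] that by blast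
  then obtain \<Phi> where \<Phi>: "\<And>i. \<Phi> i \<in> poly_mat V (?r i) (?s i)"
    "\<And>i. homogeneous_mat (ds i) (map (\<lambda>x. x + d) (es i)) (\<Phi> i)"
    "\<And>w. w \<in> G.F 0 \<Longrightarrow> e \<bullet> (\<Phi> 0 *\<^sub>v w) - m * (e' \<bullet> w) \<in> I"
    "\<And>i. D (Suc i) * \<Phi> (Suc i) = \<Phi> i * E (Suc i)"
    using chain_map_exists[OF G F m] by blast
  \<comment> \<open>The lower right block is the differential of the second resolution one degree
    lower. An empty matrix for \<open>i = 0\<close> lets the first differential of the cone share
    the block form of all others.\<close>
  define B where "B i = (case i of 0 \<Rightarrow> 0\<^sub>m 0 (?s 0) | Suc j \<Rightarrow> E (Suc j))" for i
  have B: "B i \<in> poly_mat V (l i) (?s i)" for i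
    using G.differential by (cases i) (auto simp: B_def poly_mat_zero)
  define C where "C i = (case i of 0 \<Rightarrow> 0\<^sub>m 0 0
    | Suc j \<Rightarrow> four_block_mat (D (Suc j)) (\<Phi> j) (0\<^sub>m (l j) (?r (Suc j))) (- B j))" for i
  have C_Suc: "C (Suc j) = four_block_mat (D (Suc j)) (\<Phi> j) (0\<^sub>m (l j) (?r (Suc j))) (- B j)" for j
    by (simp add: C_def)
  note cD = F.differential_carrier and cE = G.differential_carrier
    and c\<Phi> = poly_mat_carrier[OF \<Phi>(1)] and cB = poly_mat_carrier[OF B] and cf = free_module_carrier
  note [simp] = carrier_matD[OF cD] carrier_matD[OF cE] carrier_matD[OF c\<Phi>] carrier_matD[OF cB]
  have C_apply: "C (Suc i) *\<^sub>v (f @\<^sub>v g) = (D (Suc i) *\<^sub>v f + \<Phi> i *\<^sub>v g) @\<^sub>v (- (B i *\<^sub>v g))"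
    if "f \<in> carrier_vec (?r (Suc i))" "g \<in> carrier_vec (?s i)" for i f g
  proof -
    have "C (Suc i) *\<^sub>v (f @\<^sub>v g)
        = (D (Suc i) *\<^sub>v f + \<Phi> i *\<^sub>v g) @\<^sub>v (0\<^sub>m (l i) (?r (Suc i)) *\<^sub>v f + (- B i) *\<^sub>v g)"
      unfolding C_Suc using that cB[of i]
      by (intro four_block_mat_mult_vec[OF cD c\<Phi>]) auto
    also have "0\<^sub>m (l i) (?r (Suc i)) *\<^sub>v f + (- B i) *\<^sub>v g = - (B i *\<^sub>v g)"
      using that cB[of i] by (intro eq_vecI) auto
    finally show ?thesis .
  qed
  have commute: "D (Suc i) *\<^sub>v (\<Phi> (Suc i) *\<^sub>v g) = \<Phi> i *\<^sub>v (E (Suc i) *\<^sub>v g)"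
    if "g \<in> carrier_vec (?s (Suc i))" for i g
    using assoc_mult_mat_vec[OF cD c\<Phi> that] assoc_mult_mat_vec[OF c\<Phi> cE that] \<Phi>(4)[of i] by metis
  have image_cycle_F: "D (Suc i) *\<^sub>v f \<in> F.cycles i" if "f \<in> F.F (Suc i)" for i f
    using F.exact that by blast
  have image_cycle_G: "E (Suc i) *\<^sub>v g \<in> G.cycles i" if "g \<in> G.F (Suc i)" for i g
    using G.exact that by blast
  have e_add: "e \<bullet> (v + w) = e \<bullet> v + e \<bullet> w" if "v \<in> F.F 0" "w \<in> F.F 0" for v w
    by (rule scalar_prod_add_distrib[OF cf[OF F.augmentation] cf[OF that(1)] cf[OF that(2)]])

  have C_mat: "C (Suc i) \<in> poly_mat V (?r i + l i) (?r (Suc i) + ?s i)" for i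
    using F.differential[of i] \<Phi>(1)[of i] B[of i]
    by (auto simp: poly_mat_def C_Suc poly_ring_uminus)
  have C_entries: "homogeneous ((ds (Suc i) @ shifted d es (Suc i)) ! a - (ds i @ shifted d es i) ! b) (C (Suc i) $$ (b, a))
      \<and> Poly_Mapping.lookup (C (Suc i) $$ (b, a)) 0 = 0"
    if b: "b < ?r i + l i" and a: "a < ?r (Suc i) + ?s i" for i a b
  proof -
    have dims: "dim_row (D (Suc i)) = ?r i" "dim_col (D (Suc i)) = ?r (Suc i)"
      "dim_row (B i) = l i" "dim_col (B i) = ?s i"
      using cD[of i] cB[of i] by auto
    consider "b < ?r i" "a < ?r (Suc i)" | "b < ?r i" "\<not> a < ?r (Suc i)"
      | "\<not> b < ?r i" "a < ?r (Suc i)" | "\<not> b < ?r i" "\<not> a < ?r (Suc i)" by blast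
    then show ?thesis
    proof cases
      case 1
      then show ?thesis
        using a b F.differential_homogeneous[of i] F.differential_minimal[of b i a]
        by (simp add: C_Suc dims nth_append homogeneous_mat_def)
    next
      case 2
      let ?a = "a - ?r (Suc i)"
      have "homogeneous (es i ! ?a + d - ds i ! b) (\<Phi> i $$ (b, ?a))"
        using \<Phi>(2)[of i] 2 a by (auto simp: homogeneous_mat_def)
      \<comment> \<open>By \<open>deg\<close> this entry has nonzero degree, hence no constant term;
        the other blocks inherit minimality.\<close>
      moreover have "es i ! ?a + d - ds i ! b \<noteq> 0"
        using deg[of "ds i ! b" i "es i ! ?a"] 2 a by auto
      ultimately show ?thesis
        using 2 a b homogeneous_lookup_0[of "es i ! ?a + d - ds i ! b" "\<Phi> i $$ (b, ?a)"]
        by (simp add: C_Suc dims nth_append)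
    next
      case 3
      then show ?thesis using a b by (simp add: C_Suc dims)
    next
      case 4
      then obtain j where j: "i = Suc j" using b by (cases i) auto
      let ?b = "b - ?r i" and ?a = "a - ?r (Suc i)"
      have ba: "?b < ?s j" "?a < ?s (Suc j)" using 4 a b j by auto
      have "homogeneous (es (Suc j) ! ?a - es j ! ?b) (E (Suc j) $$ (?b, ?a))"
        using G.differential_homogeneous[of j] ba by (simp add: homogeneous_mat_def)
      then show ?thesis
        using 4 a b ba G.differential_minimal[OF ba] homogeneous_uminus
        by (simp add: C_Suc nth_append j B_def carrier_matD[OF cD] carrier_matD[OF cE])
    qed
  qed

  have exact_0: "{w \<in> F.F 0. e \<bullet> w \<in> K} = (\<lambda>w. C 1 *\<^sub>v w) ` free_module V (?r 1 + ?s 0)"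
  proof (intro equalityI subsetI)
    fix w assume "w \<in> {w \<in> F.F 0. e \<bullet> w \<in> K}"
    then have w: "w \<in> F.F 0" "e \<bullet> w \<in> K" by auto
    obtain g where g: "g \<in> poly_ring V" "e \<bullet> w - m * g \<in> I" using split[OF w(2)] by blast
    obtain y where y: "y \<in> G.F 0" "g - e' \<bullet> y \<in> J" using G.augmentation_surj[OF g(1)] by blast
    let ?v = "w - \<Phi> 0 *\<^sub>v y"
    have \<Phi>y: "\<Phi> 0 *\<^sub>v y \<in> F.F 0" using \<Phi>(1) y(1) by (rule poly_mat_mult_vec)
    \<comment> \<open>The image of \<open>w\<close> is \<open>m * g\<close> modulo \<open>I\<close>,
      and \<open>g\<close> is the image of \<open>y\<close> modulo \<open>J\<close>. Since m J lies
      in I, subtracting \<open>\<Phi> 0\<close> applied to \<open>y\<close> makes \<open>w\<close> a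
      cycle of the first resolution.\<close>
    have "m * (g - e' \<bullet> y) \<in> I"
      using colon y(2) homogeneous_idealD(1)[OF G.ideal] by blast
    then have "(e \<bullet> w - m * g) + m * (g - e' \<bullet> y) - (e \<bullet> (\<Phi> 0 *\<^sub>v y) - m * (e' \<bullet> y)) \<in> I"
      using g(2) \<Phi>(3)[OF y(1)] homogeneous_idealD(3,7)[OF F.ideal] by blast
    also have "(e \<bullet> w - m * g) + m * (g - e' \<bullet> y) - (e \<bullet> (\<Phi> 0 *\<^sub>v y) - m * (e' \<bullet> y)) = e \<bullet> ?v"
      using scalar_prod_minus_distrib[OF cf[OF F.augmentation] cf[OF w(1)] cf[OF \<Phi>y]]
      by (simp add: algebra_simps)
    finally have "?v \<in> F.cycles 0" using free_module_diff[OF w(1) \<Phi>y] by (simp add: F.cycles_def)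
    then obtain x where x: "x \<in> F.F 1" "?v = D 1 *\<^sub>v x" using F.exact[of 0] by auto
    have "w = D 1 *\<^sub>v x + \<Phi> 0 *\<^sub>v y"
      unfolding x(2)[symmetric] using cf[OF w(1)] cf[OF \<Phi>y] by (intro eq_vecI) auto
    also have "\<dots> = C 1 *\<^sub>v (x @\<^sub>v y)"
      using C_apply[of x 0 y] cf[OF x(1)] cf[OF y(1)] cf[OF \<Phi>y] cB[of 0] cD[of 0]
      by (intro eq_vecI) auto
    finally show "w \<in> (\<lambda>w. C 1 *\<^sub>v w) ` free_module V (?r 1 + ?s 0)"
      using free_module_append[OF x(1) y(1)] by blast
  next
    fix w assume "w \<in> (\<lambda>w. C 1 *\<^sub>v w) ` free_module V (?r 1 + ?s 0)"
    then obtain x y where x: "x \<in> F.F 1" and y: "y \<in> G.F 0" and w: "w = C 1 *\<^sub>v (x @\<^sub>v y)"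
      by (auto elim: free_module_appendE)
    have \<Phi>y: "\<Phi> 0 *\<^sub>v y \<in> F.F 0" using \<Phi>(1) y by (rule poly_mat_mult_vec)
    have Dx: "D 1 *\<^sub>v x \<in> F.F 0" "e \<bullet> (D 1 *\<^sub>v x) \<in> I"
      using image_cycle_F[of x 0] x by (auto simp: F.cycles_def)
    have w': "w = D 1 *\<^sub>v x + \<Phi> 0 *\<^sub>v y"
      unfolding w using C_apply[of x 0 y] cf[OF x] cf[OF y] cf[OF \<Phi>y] cB[of 0] cD[of 0]
      by (intro eq_vecI) auto
    have "e' \<bullet> y \<in> poly_ring V" using G.augmentation y by (rule free_module_scalar_prod)
    then have "e \<bullet> (D 1 *\<^sub>v x) + (e \<bullet> (\<Phi> 0 *\<^sub>v y) - m * (e' \<bullet> y)) + m * (e' \<bullet> y) \<in> K"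
      using Dx(2) \<Phi>(3)[OF y] IK mK homogeneous_idealD(3)[OF K] by (meson subsetD)
    then have "e \<bullet> w \<in> K" unfolding w' e_add[OF Dx(1) \<Phi>y] by (simp add: algebra_simps)
    moreover have "w \<in> F.F 0" unfolding w' using Dx(1) \<Phi>y by (rule free_module_add)
    ultimately show "w \<in> {w \<in> F.F 0. e \<bullet> w \<in> K}" by blast
  qed

  have exact_Suc: "{w \<in> free_module V (?r (Suc i) + ?s i). C (Suc i) *\<^sub>v w = 0\<^sub>v (?r i + l i)}
      = (\<lambda>w. C (Suc (Suc i)) *\<^sub>v w) ` free_module V (?r (Suc (Suc i)) + ?s (Suc i))" for i
  proof (intro equalityI subsetI)
    fix w assume "w \<in> {w \<in> free_module V (?r (Suc i) + ?s i). C (Suc i) *\<^sub>v w = 0\<^sub>v (?r i + l i)}"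
    then obtain f g where f: "f \<in> F.F (Suc i)" and g: "g \<in> G.F i" and w: "w = f @\<^sub>v g"
      and Cw: "C (Suc i) *\<^sub>v w = 0\<^sub>v (?r i + l i)"
      by (auto elim: free_module_appendE)
    have Df: "D (Suc i) *\<^sub>v f \<in> F.F i" using F.differential f by (rule poly_mat_mult_vec)
    have \<Phi>g: "\<Phi> i *\<^sub>v g \<in> F.F i" using \<Phi>(1) g by (rule poly_mat_mult_vec)
    have "0\<^sub>v (?r i + l i) = 0\<^sub>v (?r i) @\<^sub>v 0\<^sub>v (l i)" by (intro eq_vecI) auto
    then have "(D (Suc i) *\<^sub>v f + \<Phi> i *\<^sub>v g) @\<^sub>v (- (B i *\<^sub>v g)) = 0\<^sub>v (?r i) @\<^sub>v 0\<^sub>v (l i)"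
      using Cw unfolding w C_apply[OF cf[OF f] cf[OF g]] by (rule trans[rotated])
    then have "D (Suc i) *\<^sub>v f + \<Phi> i *\<^sub>v g = 0\<^sub>v (?r i) \<and> - (B i *\<^sub>v g) = 0\<^sub>v (l i)"
      by (simp only: append_vec_eq[OF add_carrier_vec[OF cf[OF Df] cf[OF \<Phi>g]] zero_carrier_vec])
    then have 1: "D (Suc i) *\<^sub>v f + \<Phi> i *\<^sub>v g = 0\<^sub>v (?r i)" and 2: "- (B i *\<^sub>v g) = 0\<^sub>v (l i)"
      by blast+
    \<comment> \<open>In positive degree this is the lower block of the equation. For
      \<open>i = 0\<close> that block is empty, and the other direction of \<open>colon\<close>,
      injectivity of multiplication by \<open>m\<close> from R/J to R/I, replaces it.\<close>
    have "g \<in> G.cycles i"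
    proof (cases i)
      case 0
      have "e \<bullet> (D (Suc i) *\<^sub>v f) + e \<bullet> (\<Phi> i *\<^sub>v g) = 0"
        using 1 e_add Df \<Phi>g F.augmentation unfolding 0 by (metis cf scalar_prod_right_zero)
      moreover have "e \<bullet> (D (Suc i) *\<^sub>v f) \<in> I"
        using image_cycle_F[OF f] unfolding 0 by (simp add: F.cycles_def)
      ultimately have "e \<bullet> (\<Phi> i *\<^sub>v g) \<in> I"
        using homogeneous_idealD(6)[OF F.ideal] by (metis add_eq_0_iff)
      then have "e \<bullet> (\<Phi> i *\<^sub>v g) - (e \<bullet> (\<Phi> i *\<^sub>v g) - m * (e' \<bullet> g)) \<in> I"
        using \<Phi>(3) g homogeneous_idealD(7)[OF F.ideal] unfolding 0 by blast
      then have "m * (e' \<bullet> g) \<in> I" by simp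
      then show ?thesis
        using colon free_module_scalar_prod[OF G.augmentation] g unfolding 0 by (simp add: G.cycles_def)
    next
      case (Suc j)
      have "B i *\<^sub>v g = 0\<^sub>v (l i)"
        using 2 by (metis uminus_uminus_vec uminus_zero_vec)
      then show ?thesis using g by (simp add: G.cycles_def Suc B_def)
    qed
    then obtain g' where g': "g' \<in> G.F (Suc i)" "g = E (Suc i) *\<^sub>v g'" using G.exact by auto
    have \<Phi>g': "\<Phi> (Suc i) *\<^sub>v g' \<in> F.F (Suc i)" using \<Phi>(1) g'(1) by (rule poly_mat_mult_vec)
    have "D (Suc i) *\<^sub>v (f + \<Phi> (Suc i) *\<^sub>v g') = D (Suc i) *\<^sub>v f + \<Phi> i *\<^sub>v g"
      using mult_add_distrib_mat_vec[OF cD cf[OF f] cf[OF \<Phi>g']] commute[OF cf[OF g'(1)]] g'(2) by simp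
    then have "f + \<Phi> (Suc i) *\<^sub>v g' \<in> F.cycles (Suc i)"
      using 1 free_module_add[OF f \<Phi>g'] by (simp add: F.cycles_def)
    then obtain f' where f': "f' \<in> F.F (Suc (Suc i))" "f + \<Phi> (Suc i) *\<^sub>v g' = D (Suc (Suc i)) *\<^sub>v f'"
      using F.exact by auto
    \<comment> \<open>The preimage is \<open>f'\<close> together with \<open>- g'\<close>, whose
      sign cancels the one in the lower right block.\<close>
    have ng': "- g' \<in> G.F (Suc i)" using g'(1) by (rule free_module_uminus)
    have "C (Suc (Suc i)) *\<^sub>v (f' @\<^sub>v (- g')) =
        (D (Suc (Suc i)) *\<^sub>v f' + \<Phi> (Suc i) *\<^sub>v (- g')) @\<^sub>v (- (B (Suc i) *\<^sub>v (- g')))"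
      by (rule C_apply[OF cf[OF f'(1)] cf[OF ng']])
    also have "\<Phi> (Suc i) *\<^sub>v (- g') = - (\<Phi> (Suc i) *\<^sub>v g')"
      by (rule mult_mat_vec_uminus[OF c\<Phi> cf[OF g'(1)]])
    also have "D (Suc (Suc i)) *\<^sub>v f' + - (\<Phi> (Suc i) *\<^sub>v g') = f"
      unfolding f'(2)[symmetric] using cf[OF f] cf[OF \<Phi>g'] by (intro eq_vecI) auto
    also have "- (B (Suc i) *\<^sub>v (- g')) = g"
      using mult_mat_vec_uminus[OF cE cf[OF g'(1)]] g'(2) by (simp add: B_def)
    finally show "w \<in> (\<lambda>w. C (Suc (Suc i)) *\<^sub>v w) ` free_module V (?r (Suc (Suc i)) + ?s (Suc i))"
      using free_module_append[OF f'(1) ng'] w by (metis imageI)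
  next
    fix w assume "w \<in> (\<lambda>w. C (Suc (Suc i)) *\<^sub>v w) ` free_module V (?r (Suc (Suc i)) + ?s (Suc i))"
    then obtain f g where f: "f \<in> F.F (Suc (Suc i))" and g: "g \<in> G.F (Suc i)"
      and w: "w = C (Suc (Suc i)) *\<^sub>v (f @\<^sub>v g)"
      by (auto elim: free_module_appendE)
    let ?x = "D (Suc (Suc i)) *\<^sub>v f" and ?y = "\<Phi> (Suc i) *\<^sub>v g" and ?z = "E (Suc i) *\<^sub>v g"
    have x: "?x \<in> F.F (Suc i)" "D (Suc i) *\<^sub>v ?x = 0\<^sub>v (?r i)"
      using image_cycle_F[OF f] by (auto simp: F.cycles_def)
    have y: "?y \<in> F.F (Suc i)" using \<Phi>(1) g by (rule poly_mat_mult_vec)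
    have z: "?z \<in> G.F i" using image_cycle_G[OF g] by (simp add: G.cycles_def)
    have nz: "- ?z \<in> G.F i" using z by (rule free_module_uminus)
    have Bz: "B i *\<^sub>v ?z = 0\<^sub>v (l i)"
    proof (cases i)
      case 0
      then show ?thesis by (intro eq_vecI) (auto simp: B_def)
    next
      case (Suc j)
      then show ?thesis using image_cycle_G[OF g] by (simp add: G.cycles_def B_def)
    qed
    have w': "w = (?x + ?y) @\<^sub>v (- ?z)"
      unfolding w using C_apply[OF cf[OF f] cf[OF g]] by (simp add: B_def)
    have \<Phi>z: "\<Phi> i *\<^sub>v ?z \<in> F.F i" using \<Phi>(1) z by (rule poly_mat_mult_vec)
    have "C (Suc i) *\<^sub>v w = (D (Suc i) *\<^sub>v (?x + ?y) + \<Phi> i *\<^sub>v (- ?z)) @\<^sub>v (- (B i *\<^sub>v (- ?z)))"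
      unfolding w' by (rule C_apply[OF cf[OF free_module_add[OF x(1) y]] cf[OF nz]])
    also have "D (Suc i) *\<^sub>v (?x + ?y) = \<Phi> i *\<^sub>v ?z"
      using mult_add_distrib_mat_vec[OF cD cf[OF x(1)] cf[OF y]] x(2) commute[OF cf[OF g]] cf[OF \<Phi>z]
      by simp
    also have "\<Phi> i *\<^sub>v (- ?z) = - (\<Phi> i *\<^sub>v ?z)"
      by (rule mult_mat_vec_uminus[OF c\<Phi> cf[OF z]])
    also have "- (B i *\<^sub>v (- ?z)) = 0\<^sub>v (l i)"
      using mult_mat_vec_uminus[OF cB cf[OF z]] Bz by simp
    also have "(\<Phi> i *\<^sub>v ?z + - (\<Phi> i *\<^sub>v ?z)) @\<^sub>v 0\<^sub>v (l i) = 0\<^sub>v (?r i + l i)"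
      using cf[OF \<Phi>z] by (intro eq_vecI) auto
    finally show "w \<in> {w \<in> free_module V (?r (Suc i) + ?s i). C (Suc i) *\<^sub>v w = 0\<^sub>v (?r i + l i)}"
      using free_module_append[OF free_module_add[OF x(1) y] nz] w' by simp
  qed

  have "graded_resolution V K (\<lambda>i. ds i @ shifted d es i) e C"
    unfolding graded_resolution_def minimal_graded_free_resolution_def Let_def
  proof (intro conjI)
    show "\<forall>f\<in>poly_ring V. \<exists>w\<in>free_module V (length (ds 0 @ shifted d es 0)). f - e \<bullet> w \<in> K"
      using F.augmentation_surj IK by fastforce
    show "\<forall>i. C (Suc i) \<in> carrier_mat (length (ds i @ shifted d es i)) (length (ds (Suc i) @ shifted d es (Suc i))) \<and>
      (\<forall>b<length (ds i @ shifted d es i). \<forall>a<length (ds (Suc i) @ shifted d es (Suc i)).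
        C (Suc i) $$ (b, a) \<in> poly_ring V \<and>
        homogeneous ((ds (Suc i) @ shifted d es (Suc i)) ! a - (ds i @ shifted d es i) ! b) (C (Suc i) $$ (b, a)) \<and>
        Poly_Mapping.lookup (C (Suc i) $$ (b, a)) 0 = 0)"
    proof (intro allI conjI impI)
      fix i
      show "C (Suc i) \<in> carrier_mat (length (ds i @ shifted d es i)) (length (ds (Suc i) @ shifted d es (Suc i)))"
        using poly_mat_carrier[OF C_mat[of i]] by (simp add: l_def)
      fix b a assume "b < length (ds i @ shifted d es i)" "a < length (ds (Suc i) @ shifted d es (Suc i))"
      then have ba: "b < ?r i + l i" "a < ?r (Suc i) + ?s i" by (simp_all add: l_def)
      then show "C (Suc i) $$ (b, a) \<in> poly_ring V"
        using C_mat[of i] by (simp add: poly_mat_def)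
      show "homogeneous ((ds (Suc i) @ shifted d es (Suc i)) ! a - (ds i @ shifted d es i) ! b) (C (Suc i) $$ (b, a))"
        "Poly_Mapping.lookup (C (Suc i) $$ (b, a)) 0 = 0"
        using C_entries[OF ba] by auto
    qed
    show "{w \<in> free_module V (length (ds 0 @ shifted d es 0)). e \<bullet> w \<in> K} =
        (*\<^sub>v) (C 1) ` free_module V (length (ds 1 @ shifted d es 1))"
      using exact_0 by simp
    show "\<forall>i. {w \<in> free_module V (length (ds (Suc i) @ shifted d es (Suc i))).
          C (Suc i) *\<^sub>v w = 0\<^sub>v (length (ds i @ shifted d es i))} =
        (*\<^sub>v) (C (Suc (Suc i))) ` free_module V (length (ds (Suc (Suc i)) @ shifted d es (Suc (Suc i))))"
      using exact_Suc by (simp add: l_def)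
  qed (use K F.augmentation F.augmentation_homogeneous in auto)
  then show ?thesis by blast
qed

section \<open>Monomial ideals\<close>

lemma lookup_single_mult:
  fixes q :: "nat \<Rightarrow>\<^sub>0 nat" and f :: "'k::field polynomial"
  shows "Poly_Mapping.lookup (Poly_Mapping.single q 1 * f) (q + t) = Poly_Mapping.lookup f t"
proof -
  let ?c = "Poly_Mapping.single t (Poly_Mapping.lookup f t)"
  have "q + t \<notin> Poly_Mapping.keys (Poly_Mapping.single q 1 * (f - ?c))"
  proof
    assume "q + t \<in> Poly_Mapping.keys (Poly_Mapping.single q 1 * (f - ?c))"
    then obtain a b where "q + t = a + b" "a \<in> Poly_Mapping.keys (Poly_Mapping.single q (1::'k))"
      "b \<in> Poly_Mapping.keys (f - ?c)" by (rule keys_multE)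
    then show False by (auto simp: in_keys_iff lookup_minus)
  qed
  moreover have "Poly_Mapping.single q 1 * f
      = Poly_Mapping.single q 1 * (f - ?c) + Poly_Mapping.single (q + t) (Poly_Mapping.lookup f t)"
    by (simp add: algebra_simps mult_single)
  ultimately show ?thesis by (simp add: lookup_add in_keys_iff)
qed

text \<open>Multiplication by a monomial translates exponents injectively, so no terms merge. The
  colon of a monomial ideal thus becomes a substitution in its predicate.\<close>

lemma keys_single_mult:
  fixes q :: "nat \<Rightarrow>\<^sub>0 nat" and f :: "'k::field polynomial"
  shows "Poly_Mapping.keys (Poly_Mapping.single q 1 * f) = (\<lambda>t. q + t) ` Poly_Mapping.keys f"
proof (intro equalityI subsetI)
  fix m assume "m \<in> Poly_Mapping.keys (Poly_Mapping.single q 1 * f)"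
  then show "m \<in> (\<lambda>t. q + t) ` Poly_Mapping.keys f"
    by (rule keys_multE) auto
next
  fix m assume "m \<in> (\<lambda>t. q + t) ` Poly_Mapping.keys f"
  then show "m \<in> Poly_Mapping.keys (Poly_Mapping.single q 1 * f)"
    by (auto simp: in_keys_iff lookup_single_mult)
qed

definition upward_closed :: "((nat \<Rightarrow>\<^sub>0 nat) \<Rightarrow> bool) \<Rightarrow> bool" where
  "upward_closed P \<longleftrightarrow> (\<forall>m q. P m \<longrightarrow> P (m + q))"

text \<open>Encoding the ideal by a predicate on exponents makes ideal arithmetic logical: adjoining
  a monomial is a disjunction, and the colon by \<open>q\<close> is
  \<open>P (q + m)\<close>.\<close>

definition monomial_ideal :: "nat set \<Rightarrow> ((nat \<Rightarrow>\<^sub>0 nat) \<Rightarrow> bool) \<Rightarrow> 'k::field polynomial set" where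
  "monomial_ideal V P = {f \<in> poly_ring V. \<forall>m \<in> Poly_Mapping.keys f. P m}"

lemma homogeneous_ideal_monomial_ideal:
  assumes "upward_closed P"
  shows "homogeneous_ideal V (monomial_ideal V P)"
  unfolding homogeneous_ideal_def
proof (intro conjI ballI allI)
  fix f g :: "'a polynomial" assume "f \<in> monomial_ideal V P" "g \<in> monomial_ideal V P"
  then show "f + g \<in> monomial_ideal V P"
    using Poly_Mapping.keys_add[of f g] by (auto simp: monomial_ideal_def poly_ring_add)
next
  fix r f :: "'a polynomial" assume r: "r \<in> poly_ring V" and f: "f \<in> monomial_ideal V P"
  have "P m" if "m \<in> Poly_Mapping.keys (r * f)" for m
    using that
  proof (rule keys_multE)
    fix a b assume "m = a + b" "b \<in> Poly_Mapping.keys f"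
    then show "P m"
      using assms f by (simp add: upward_closed_def monomial_ideal_def add.commute[of a])
  qed
  then show "r * f \<in> monomial_ideal V P"
    using r f by (simp add: monomial_ideal_def poly_ring_mult)
next
  fix f :: "'a polynomial" and d assume "f \<in> monomial_ideal V P"
  then show "hom_part d f \<in> monomial_ideal V P"
    by (simp add: monomial_ideal_def hom_part_def poly_ring_restrict_keys keys_restrict_keys)
qed (auto simp: monomial_ideal_def)

lemma single_mem_monomial_ideal:
  "Poly_Mapping.keys m \<subseteq> V \<Longrightarrow> P m \<Longrightarrow> Poly_Mapping.single m c \<in> monomial_ideal V P"
  by (cases "c = 0") (auto simp: monomial_ideal_def poly_ring_single)

lemma sum_single_lookup: "(\<Sum>m\<in>Poly_Mapping.keys f. Poly_Mapping.single m (Poly_Mapping.lookup f m)) = f"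
  using restrict_keys_id[of f "\<lambda>_. True"] by (simp add: restrict_keys_def)

lemma ideal_gen_monomials:
  fixes M :: "(nat \<Rightarrow>\<^sub>0 nat) set"
  assumes fin: "finite M" and M: "\<And>q. q \<in> M \<Longrightarrow> Poly_Mapping.keys q \<subseteq> V"
  shows "(ideal_gen V ((\<lambda>q. Poly_Mapping.single q 1) ` M) :: 'k::field polynomial set)
    = monomial_ideal V (\<lambda>m. \<exists>q\<in>M. \<exists>t. m = q + t)"
proof (intro equalityI subsetI)
  let ?P = "\<lambda>m. \<exists>q\<in>M. \<exists>t. m = q + t" and ?S = "(\<lambda>q. Poly_Mapping.single q (1::'k)) ` M"
  have "upward_closed ?P" unfolding upward_closed_def by (metis add.assoc)
  then have I: "homogeneous_ideal V (monomial_ideal V ?P :: 'k polynomial set)"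
    by (rule homogeneous_ideal_monomial_ideal)
  fix f :: "'k polynomial"
  {
    assume "f \<in> ideal_gen V ?S"
    then obtain c where f: "f = (\<Sum>g\<in>?S. c g * g)" and c: "\<forall>g\<in>?S. c g \<in> poly_ring V"
      by (auto simp: ideal_gen_def)
    have "g \<in> monomial_ideal V ?P" if "g \<in> ?S" for g
    proof -
      obtain q where q: "q \<in> M" "g = Poly_Mapping.single q 1" using \<open>g \<in> ?S\<close> by blast
      then have "\<exists>q'\<in>M. \<exists>t. q = q' + t" by (intro bexI[of _ q] exI[of _ 0]) simp_all
      then show ?thesis using q M by (simp add: single_mem_monomial_ideal)
    qed
    then show "f \<in> monomial_ideal V ?P"
      unfolding f using c by (intro homogeneous_ideal_sum[OF I] homogeneous_idealD(4)[OF I]) auto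
  }
  assume f: "f \<in> monomial_ideal V ?P"
  let ?K = "Poly_Mapping.keys f"
  have "\<forall>m. \<exists>q. m \<in> ?K \<longrightarrow> q \<in> M \<and> (\<exists>t. m = q + t)" using f unfolding monomial_ideal_def by blast
  then obtain q where q: "\<And>m. m \<in> ?K \<Longrightarrow> q m \<in> M \<and> (\<exists>t. m = q m + t)" by metis
  \<comment> \<open>Each term of \<open>f\<close> is assigned to one generator dividing it;
    \<open>c g\<close> collects the cofactors of all terms assigned to \<open>g\<close>, as
    \<open>ideal_gen\<close> allows one coefficient per generator.\<close>
  define c where "c g = (\<Sum>m\<in>{m \<in> ?K. Poly_Mapping.single (q m) 1 = g}.
    Poly_Mapping.single (m - q m) (Poly_Mapping.lookup f m))" for g :: "'k polynomial"
  have diff: "m - q m + q m = m" if "m \<in> ?K" for m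
    using q[OF that] by (metis add_diff_cancel_left' add.commute)
  have "f = (\<Sum>m\<in>?K. Poly_Mapping.single (m - q m) (Poly_Mapping.lookup f m) * Poly_Mapping.single (q m) 1)"
    by (subst sum_single_lookup[symmetric]) (simp add: mult_single diff)
  also have "\<dots> = (\<Sum>g\<in>?S. \<Sum>m\<in>{m \<in> ?K. Poly_Mapping.single (q m) 1 = g}.
      Poly_Mapping.single (m - q m) (Poly_Mapping.lookup f m) * Poly_Mapping.single (q m) 1)"
    using q fin by (intro sum.group[symmetric]) auto
  also have "\<dots> = (\<Sum>g\<in>?S. c g * g)"
    unfolding c_def sum_distrib_right by (intro sum.cong refl) simp
  finally have "f = (\<Sum>g\<in>?S. c g * g)" .
  moreover have "c g \<in> poly_ring V" for g
    unfolding c_def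
  proof (intro poly_ring_sum poly_ring_single)
    fix m assume "m \<in> {m \<in> ?K. Poly_Mapping.single (q m) 1 = g}"
    then have "m \<in> ?K" by simp
    then have "Poly_Mapping.keys (m - q m) \<subseteq> Poly_Mapping.keys m"
      using diff keys_add_nat by (metis Un_upper1)
    then show "Poly_Mapping.keys (m - q m) \<subseteq> V"
      using f \<open>m \<in> ?K\<close> by (auto simp: monomial_ideal_def poly_ring_def)
  qed
  ultimately show "f \<in> ideal_gen V ?S" by (auto simp: ideal_gen_def)
qed

text \<open>From here on only the degrees of the generators matter, so the maps are hidden. The type
  argument records the field, which \<open>P\<close> and \<open>ds\<close> do not mention.\<close>

definition resolved_by :: "'k::field itself \<Rightarrow> nat set \<Rightarrow> ((nat \<Rightarrow>\<^sub>0 nat) \<Rightarrow> bool) \<Rightarrow> (nat \<Rightarrow> int list) \<Rightarrow> bool" where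
  "resolved_by _ V P ds \<longleftrightarrow>
     (\<exists>e D. graded_resolution V (monomial_ideal V P :: 'k polynomial set) ds e D)"

text \<open>This is the mapping cone for the exact sequence 0 -> R/(I : x^q)(-deg q) -> R/I -> R/(I
  + (x^q)) -> 0, written in predicates.\<close>

lemma resolved_by_cone:
  assumes P: "upward_closed P" and q: "Poly_Mapping.keys q \<subseteq> V"
    and ds: "resolved_by TYPE('k::field) V P ds"
    and es: "resolved_by TYPE('k) V (\<lambda>m. P (q + m)) es"
    and deg: "\<And>i a b. a \<in> set (ds i) \<Longrightarrow> b \<in> set (es i) \<Longrightarrow> a \<noteq> b + int (monom_degree q)"
  shows "resolved_by TYPE('k) V (\<lambda>m. P m \<or> (\<exists>t. m = q + t))
    (\<lambda>i. ds i @ shifted (int (monom_degree q)) es i)"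
proof -
  let ?m = "Poly_Mapping.single q 1 :: 'k polynomial" and ?d = "int (monom_degree q)"
  let ?K = "\<lambda>m. P m \<or> (\<exists>t. m = q + t)"
  obtain e D where F: "graded_resolution V (monomial_ideal V P :: 'k polynomial set) ds e D"
    using ds by (auto simp: resolved_by_def)
  obtain e' E where G: "graded_resolution V (monomial_ideal V (\<lambda>m. P (q + m)) :: 'k polynomial set) es e' E"
    using es by (auto simp: resolved_by_def)
  have K: "homogeneous_ideal V (monomial_ideal V ?K :: 'k polynomial set)"
  proof (rule homogeneous_ideal_monomial_ideal)
    show "upward_closed ?K" using P unfolding upward_closed_def by (metis add.assoc)
  qed
  have m: "?m \<in> poly_ring V" "homogeneous ?d ?m"
    using q by (auto simp: homogeneous_def intro: poly_ring_single)
  have "\<exists>C. graded_resolution V (monomial_ideal V ?K) (\<lambda>i. ds i @ shifted ?d es i) e C"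
  proof (rule mapping_cone[OF F G K m])
    show "monomial_ideal V P \<subseteq> (monomial_ideal V ?K :: 'k polynomial set)"
      by (auto simp: monomial_ideal_def)
    show "?m * g \<in> monomial_ideal V ?K" if "g \<in> poly_ring V" for g
      using poly_ring_mult[OF m(1) that] by (auto simp: monomial_ideal_def keys_single_mult)
    show "g \<in> monomial_ideal V (\<lambda>m. P (q + m)) \<longleftrightarrow> ?m * g \<in> monomial_ideal V P" if "g \<in> poly_ring V" for g
      using poly_ring_mult[OF m(1) that] that by (auto simp: monomial_ideal_def keys_single_mult)
    show "\<exists>g\<in>poly_ring V. f - ?m * g \<in> monomial_ideal V P" if f: "f \<in> monomial_ideal V ?K" for f
    proof -
      \<comment> \<open>The terms of \<open>f\<close> outside \<open>P\<close> are all divisible by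
        the new monomial; \<open>g\<close> is their quotient.\<close>
      let ?f = "restrict_keys (\<lambda>m. \<not> P m) f"
      define g where "g = (\<Sum>m\<in>Poly_Mapping.keys ?f. Poly_Mapping.single (m - q) (Poly_Mapping.lookup ?f m))"
      have diff: "q + (m - q) = m" if "m \<in> Poly_Mapping.keys ?f" for m
        using that f by (auto simp: keys_restrict_keys monomial_ideal_def)
      have "g \<in> poly_ring V"
        unfolding g_def
      proof (intro poly_ring_sum poly_ring_single)
        fix m assume m: "m \<in> Poly_Mapping.keys ?f"
        then have "Poly_Mapping.keys (m - q) \<subseteq> Poly_Mapping.keys m"
          using diff keys_add_nat by (metis Un_upper2)
        then show "Poly_Mapping.keys (m - q) \<subseteq> V"
          using m f by (auto simp: keys_restrict_keys monomial_ideal_def poly_ring_def)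
      qed
      moreover have "?m * g = ?f"
        unfolding g_def sum_distrib_left
        by (subst (5) sum_single_lookup[symmetric]) (simp add: mult_single diff)
      then have "f - ?m * g = restrict_keys P f"
        using restrict_keys_split[of f P] by (metis add_diff_cancel_right')
      then have "f - ?m * g \<in> monomial_ideal V P"
        using f by (simp add: monomial_ideal_def poly_ring_restrict_keys keys_restrict_keys)
      ultimately show ?thesis by blast
    qed
  qed (use deg in blast)
  then show ?thesis by (auto simp: resolved_by_def)
qed

text \<open>The ring resolves itself; both the Koszul induction and the induction over vertices
  start here.\<close>

lemma resolved_by_zero_ideal:
  "resolved_by TYPE('k::field) V (\<lambda>_. False) (\<lambda>i. if i = 0 then [0] else [])"
proof -
  let ?e = "vec (Suc 0) (\<lambda>_. 1) :: 'k polynomial vec"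
  let ?ds = "\<lambda>i :: nat. if i = 0 then [0 :: int] else []"
  let ?D = "\<lambda>i. 0\<^sub>m (length (?ds (i - 1))) 0 :: 'k polynomial mat"
  have zero: "monomial_ideal V (\<lambda>_. False) = {0 :: 'k polynomial}"
    by (auto simp: monomial_ideal_def)
  have e: "?e \<bullet> w = w $ 0" if "w \<in> carrier_vec (Suc 0)" for w
    using that by (simp add: scalar_prod_def)
  have triv: "free_module V 0 = {vNil :: 'k polynomial vec}"
    by (auto simp: free_module_def)
  have "minimal_graded_free_resolution V {0} ?ds ?e ?D"
    unfolding minimal_graded_free_resolution_def Let_def
  proof (intro conjI)
    show "\<forall>f\<in>poly_ring V. \<exists>w\<in>free_module V (length (?ds 0)). f - ?e \<bullet> w \<in> {0}"
    proof
      fix f :: "'k polynomial" assume "f \<in> poly_ring V"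
      then show "\<exists>w\<in>free_module V (length (?ds 0)). f - ?e \<bullet> w \<in> {0}"
        by (intro bexI[of _ "vec 1 (\<lambda>_. f)"]) (auto simp: e free_module_def)
    qed
    show "{w \<in> free_module V (length (?ds 0)). ?e \<bullet> w \<in> {0}} = (*\<^sub>v) (?D 1) ` free_module V (length (?ds 1))"
    proof -
      have "{w \<in> free_module V 1. ?e \<bullet> w = 0} = {0\<^sub>v 1}"
        by (auto simp: free_module_def e intro!: eq_vecI)
      moreover have "0\<^sub>m 1 0 *\<^sub>v vNil = (0\<^sub>v 1 :: 'k polynomial vec)"
        by (intro eq_vecI) auto
      ultimately show ?thesis by (simp add: triv)
    qed
    show "\<forall>i. {w \<in> free_module V (length (?ds (Suc i))). ?D (Suc i) *\<^sub>v w = 0\<^sub>v (length (?ds i))}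
        = (*\<^sub>v) (?D (Suc (Suc i))) ` free_module V (length (?ds (Suc (Suc i))))"
    proof
      fix i
      have "0\<^sub>m r 0 *\<^sub>v vNil = (0\<^sub>v r :: 'k polynomial vec)" for r
        by (intro eq_vecI) auto
      moreover have "0\<^sub>m 0 0 *\<^sub>v vNil = (vNil :: 'k polynomial vec)"
        by (intro eq_vecI) auto
      ultimately show "{w \<in> free_module V (length (?ds (Suc i))). ?D (Suc i) *\<^sub>v w = 0\<^sub>v (length (?ds i))}
        = (*\<^sub>v) (?D (Suc (Suc i))) ` free_module V (length (?ds (Suc (Suc i))))"
        by (auto simp: triv)
    qed
  qed (auto simp: free_module_def)
  moreover have "homogeneous_ideal V (monomial_ideal V (\<lambda>_. False) :: 'k polynomial set)"
    by (rule homogeneous_ideal_monomial_ideal) (simp add: upward_closed_def)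
  ultimately show ?thesis by (auto simp: resolved_by_def graded_resolution_def zero)
qed

section \<open>Ideals of variables and linear quotients\<close>

abbreviation variable :: "nat \<Rightarrow> nat \<Rightarrow>\<^sub>0 nat" where
  "variable v \<equiv> Poly_Mapping.single v (Suc 0)"

lemma variable_le_iff: "(\<exists>t. m = variable v + t) \<longleftrightarrow> Poly_Mapping.lookup m v \<noteq> 0"
proof
  assume "Poly_Mapping.lookup m v \<noteq> 0"
  then have "m = variable v + (m - variable v)"
    by (intro poly_mapping_eqI) (auto simp: lookup_add lookup_minus lookup_single when_def)
  then show "\<exists>t. m = variable v + t" ..
qed (auto simp: lookup_add)

lemma two_variables_le_iff:
  assumes "u \<noteq> v"
  shows "(\<exists>t. m = variable u + variable v + t) \<longleftrightarrow> Poly_Mapping.lookup m u \<noteq> 0 \<and> Poly_Mapping.lookup m v \<noteq> 0"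
proof
  assume "Poly_Mapping.lookup m u \<noteq> 0 \<and> Poly_Mapping.lookup m v \<noteq> 0"
  then have "m = variable u + variable v + (m - (variable u + variable v))"
    using assms by (intro poly_mapping_eqI) (auto simp: lookup_add lookup_minus lookup_single when_def)
  then show "\<exists>t. m = variable u + variable v + t" ..
qed (auto simp: lookup_add)

lemma monom_degree_variable: "monom_degree (variable v) = 1"
  by (simp add: monom_degree_def)

text \<open>Iterated cones of multiplication by a variable give the Koszul resolution.\<close>

lemma resolved_by_variables:
  assumes "finite U" "U \<subseteq> V"
  shows "resolved_by TYPE('k::field) V (\<lambda>m. \<exists>u\<in>U. Poly_Mapping.lookup m u \<noteq> 0)
    (\<lambda>i. replicate (card U choose i) (int i))"
  using assms
proof (induction U rule: finite_induct)
  case empty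
  have "(\<lambda>i. replicate (card ({} :: nat set) choose i) (int i)) = (\<lambda>i. if i = 0 then [0] else [])"
    by (intro ext) (simp add: binomial_eq_0)
  then show ?case using resolved_by_zero_ideal[where 'k = 'k, of V] by simp
next
  case (insert v U)
  let ?P = "\<lambda>m. \<exists>u\<in>U. Poly_Mapping.lookup m u \<noteq> 0" and ?ds = "\<lambda>i. replicate (card U choose i) (int i)"
  \<comment> \<open>As \<open>v\<close> is not in \<open>U\<close>, its variable is a nonzerodivisor
    modulo those of \<open>U\<close>: the colon ideal is the ideal itself, and the cone joins two
    copies of one resolution.\<close>
  have "?P (variable v + m) = ?P m" for m
    using insert.hyps by (auto simp: lookup_add lookup_single when_def)
  then have colon: "resolved_by TYPE('k) V (\<lambda>m. ?P (variable v + m)) ?ds"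
    using insert by simp
  have "resolved_by TYPE('k) V (\<lambda>m. ?P m \<or> (\<exists>t. m = variable v + t))
      (\<lambda>i. ?ds i @ shifted (int (monom_degree (variable v))) ?ds i)"
    using insert by (intro resolved_by_cone[OF _ _ _ colon]) (auto simp: upward_closed_def lookup_add monom_degree_variable)
  also have "(\<lambda>m. ?P m \<or> (\<exists>t. m = variable v + t)) = (\<lambda>m. \<exists>u\<in>insert v U. Poly_Mapping.lookup m u \<noteq> 0)"
    unfolding variable_le_iff by auto
  also have "(\<lambda>i. ?ds i @ shifted (int (monom_degree (variable v))) ?ds i)
      = (\<lambda>i. replicate (card (insert v U) choose i) (int i))"
  proof
    fix i
    \<comment> \<open>In positive degree this is Pascal's rule; the twist by 1 matches the
      homological shift, so all generators in position \<open>i\<close> have degree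
      \<open>i\<close>.\<close>
    show "?ds i @ shifted (int (monom_degree (variable v))) ?ds i = replicate (card (insert v U) choose i) (int i)"
      using insert.hyps by (cases i) (simp_all add: monom_degree_variable add.commute flip: replicate_add)
  qed
  finally show ?case .
qed

text \<open>The shape of a linear resolution for an ideal generated by quadrics. Fixing position 0
  separately also makes the truncated \<open>i - 1\<close> in later binomials harmless.\<close>

definition linear_shape :: "(nat \<Rightarrow> nat) \<Rightarrow> nat \<Rightarrow> int list" where
  "linear_shape \<beta> i = (if i = 0 then [0] else replicate (\<beta> i) (int i + 1))"

text \<open>The Koszul resolution of the colon ideal, moved one position up and twisted by 2, lies
  in degree \<open>i + 1\<close> again, so linearity persists. Minimality holds since
  \<open>i + 2\<close> occurs among the old degrees in no position \<open>i\<close>.\<close>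

lemma resolved_by_linear_quotient:
  assumes P: "upward_closed P" and uv: "u \<in> V" "v \<in> V" and U: "finite U" "U \<subseteq> V"
    and res: "resolved_by TYPE('k::field) V P (linear_shape \<beta>)"
    and colon: "\<And>m. P (variable u + variable v + m) \<longleftrightarrow> (\<exists>w\<in>U. Poly_Mapping.lookup m w \<noteq> 0)"
  shows "resolved_by TYPE('k) V (\<lambda>m. P m \<or> (\<exists>t. m = variable u + variable v + t))
    (linear_shape (\<lambda>i. \<beta> i + (card U choose (i - 1))))"
proof -
  let ?q = "variable u + variable v" and ?es = "\<lambda>i. replicate (card U choose i) (int i)"
  have d: "int (monom_degree ?q) = 2" by (simp add: monom_degree_add monom_degree_variable)
  have "resolved_by TYPE('k) V (\<lambda>m. P m \<or> (\<exists>t. m = ?q + t))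
      (\<lambda>i. linear_shape \<beta> i @ shifted (int (monom_degree ?q)) ?es i)"
  proof (rule resolved_by_cone[OF P _ res])
    show "resolved_by TYPE('k) V (\<lambda>m. P (?q + m)) ?es"
      unfolding colon by (rule resolved_by_variables[OF U])
    show "Poly_Mapping.keys ?q \<subseteq> V" using uv by (simp add: keys_add_nat)
  qed (auto simp: linear_shape_def d split: if_splits)
  also have "(\<lambda>i. linear_shape \<beta> i @ shifted (int (monom_degree ?q)) ?es i)
      = linear_shape (\<lambda>i. \<beta> i + (card U choose (i - 1)))"
  proof
    fix i
    show "linear_shape \<beta> i @ shifted (int (monom_degree ?q)) ?es i
        = linear_shape (\<lambda>i. \<beta> i + (card U choose (i - 1))) i"
      unfolding d by (cases i) (simp_all add: linear_shape_def add.commute flip: replicate_add)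
  qed
  finally show ?thesis .
qed

section \<open>Threshold graphs\<close>

text \<open>The bound on \<open>v\<close> is strict so that induction can add one vertex at a time;
  the graph on {0..n} corresponds to \<open>n + 1\<close>.\<close>

definition threshold_betti :: "nat \<Rightarrow> nat set \<Rightarrow> nat \<Rightarrow> nat" where
  "threshold_betti n \<sigma> k = (\<Sum>v\<in>\<sigma> \<inter> {..<n}. \<Sum>u<v. (u + card (\<sigma> \<inter> {u<..<v})) choose (k - 1))"

definition nonedge_monomial :: "nat set \<Rightarrow> nat \<Rightarrow> (nat \<Rightarrow>\<^sub>0 nat) \<Rightarrow> bool" where
  "nonedge_monomial \<sigma> l m \<longleftrightarrow>
     (\<exists>v\<in>\<sigma>. v < l \<and> Poly_Mapping.lookup m v \<noteq> 0 \<and> (\<exists>u<v. Poly_Mapping.lookup m u \<noteq> 0))"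

text \<open>The left side says that an earlier generator divides x_u x_v m. For w < u it is x_w x_v,
  for w in \<sigma> between u and v it is x_u x_w. Conversely, let x_a x_b with a < b < v divide: if
  b <= u then a < u and x_a divides m, otherwise x_b does.\<close>

lemma nonedge_colon:
  assumes "u < v" "v \<in> \<sigma>"
  shows "nonedge_monomial \<sigma> v (variable u + variable v + m)
      \<or> (\<exists>u'<u. Poly_Mapping.lookup (variable u + variable v + m) u' \<noteq> 0)
    \<longleftrightarrow> (\<exists>w \<in> {..<u} \<union> (\<sigma> \<inter> {u<..<v}). Poly_Mapping.lookup m w \<noteq> 0)"
    (is "?L \<longleftrightarrow> ?R")
proof
  assume ?R
  then obtain w where w: "w \<in> {..<u} \<union> (\<sigma> \<inter> {u<..<v})" "Poly_Mapping.lookup m w \<noteq> 0" by blast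
  show ?L
  proof (cases "w < u")
    case True
    then show ?thesis using w by (auto simp: lookup_add)
  next
    case False
    then have "nonedge_monomial \<sigma> v (variable u + variable v + m)"
      using w unfolding nonedge_monomial_def by (auto simp: lookup_add intro!: bexI[of _ w] exI[of _ u])
    then show ?thesis ..
  qed
next
  assume ?L
  then show ?R
  proof
    assume "nonedge_monomial \<sigma> v (variable u + variable v + m)"
    then obtain a b where ab: "b \<in> \<sigma>" "b < v" "a < b"
      and a: "a = u \<or> Poly_Mapping.lookup m a \<noteq> 0" and b: "b = u \<or> Poly_Mapping.lookup m b \<noteq> 0"
      by (auto simp: nonedge_monomial_def lookup_add lookup_single when_def split: if_splits)
    show ?R
    proof (cases "b \<le> u")
      case True
      then show ?thesis using ab a by (intro bexI[of _ a]) auto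
    next
      case False
      then show ?thesis using ab b by (intro bexI[of _ b]) auto
    qed
  next
    assume "\<exists>u'<u. Poly_Mapping.lookup (variable u + variable v + m) u' \<noteq> 0"
    then obtain u' where "u' < u" "Poly_Mapping.lookup (variable u + variable v + m) u' \<noteq> 0" by blast
    then show ?R
      using assms by (intro bexI[of _ u']) (auto simp: lookup_add lookup_single when_def)
  qed
qed

text \<open>For a fixed larger endpoint \<open>v\<close> the generators are adjoined by increasing
  smaller endpoint; \<open>l\<close> counts those already present.\<close>

lemma resolved_by_vertex:
  assumes v: "v \<in> \<sigma>" "v \<in> V" and V: "{..<v} \<subseteq> V" and "l \<le> v"
    and res: "resolved_by TYPE('k::field) V (nonedge_monomial \<sigma> v) (linear_shape \<beta>)"
  shows "resolved_by TYPE('k) V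
    (\<lambda>m. nonedge_monomial \<sigma> v m \<or> Poly_Mapping.lookup m v \<noteq> 0 \<and> (\<exists>u<l. Poly_Mapping.lookup m u \<noteq> 0))
    (linear_shape (\<lambda>i. \<beta> i + (\<Sum>u<l. (u + card (\<sigma> \<inter> {u<..<v})) choose (i - 1))))"
  using \<open>l \<le> v\<close>
proof (induction l)
  case 0
  then show ?case using res by simp
next
  case (Suc u)
  let ?P = "\<lambda>m. nonedge_monomial \<sigma> v m \<or> Poly_Mapping.lookup m v \<noteq> 0 \<and> (\<exists>w<u. Poly_Mapping.lookup m w \<noteq> 0)"
  let ?\<beta> = "\<lambda>i. \<beta> i + (\<Sum>w<u. (w + card (\<sigma> \<inter> {w<..<v})) choose (i - 1))"
  let ?U = "{..<u} \<union> (\<sigma> \<inter> {u<..<v})"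
  have card: "card ?U = u + card (\<sigma> \<inter> {u<..<v})"
    by (subst card_Un_disjoint) auto
  have "resolved_by TYPE('k) V (\<lambda>m. ?P m \<or> (\<exists>t. m = variable u + variable v + t))
      (linear_shape (\<lambda>i. ?\<beta> i + (card ?U choose (i - 1))))"
  proof (rule resolved_by_linear_quotient)
    show "upward_closed ?P"
      by (fastforce simp: upward_closed_def nonedge_monomial_def lookup_add)
    show "u \<in> V" "v \<in> V" "finite ?U" "?U \<subseteq> V"
      using V v(2) Suc.prems by auto
    show "resolved_by TYPE('k) V ?P (linear_shape ?\<beta>)"
      using Suc by simp
    show "?P (variable u + variable v + m) \<longleftrightarrow> (\<exists>w\<in>?U. Poly_Mapping.lookup m w \<noteq> 0)" for m
      using nonedge_colon[of u v \<sigma> m] Suc.prems v(1) by (simp add: lookup_add)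
  qed
  also have "(\<lambda>m. ?P m \<or> (\<exists>t. m = variable u + variable v + t))
      = (\<lambda>m. nonedge_monomial \<sigma> v m \<or> Poly_Mapping.lookup m v \<noteq> 0 \<and> (\<exists>w<Suc u. Poly_Mapping.lookup m w \<noteq> 0))"
    using Suc.prems two_variables_le_iff[of u v] by (auto simp: less_Suc_eq)
  also have "(\<lambda>i. ?\<beta> i + (card ?U choose (i - 1)))
      = (\<lambda>i. \<beta> i + (\<Sum>w<Suc u. (w + card (\<sigma> \<inter> {w<..<v})) choose (i - 1)))"
    unfolding card by (simp add: add.assoc)
  finally show ?case .
qed

text \<open>The ring stays fixed while vertices are processed one by one, hence an arbitrary
  \<open>V\<close> containing the first \<open>l\<close> vertices.\<close>

lemma resolved_by_nonedges:
  assumes "{..<l} \<subseteq> V"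
  shows "resolved_by TYPE('k::field) V (nonedge_monomial \<sigma> l) (linear_shape (threshold_betti l \<sigma>))"
  using assms
proof (induction l)
  case 0
  have "nonedge_monomial \<sigma> 0 = (\<lambda>_. False)" by (simp add: nonedge_monomial_def fun_eq_iff)
  moreover have "linear_shape (threshold_betti 0 \<sigma>) = (\<lambda>i. if i = 0 then [0] else [])"
    by (simp add: linear_shape_def threshold_betti_def fun_eq_iff)
  ultimately show ?case using resolved_by_zero_ideal[where 'k = 'k, of V] by simp
next
  case (Suc v)
  then have IH: "resolved_by TYPE('k) V (nonedge_monomial \<sigma> v) (linear_shape (threshold_betti v \<sigma>))"
    by (simp add: lessThan_Suc)
  show ?case
  proof (cases "v \<in> \<sigma>")
    case True
    have "nonedge_monomial \<sigma> (Suc v) = (\<lambda>m. nonedge_monomial \<sigma> v m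
        \<or> Poly_Mapping.lookup m v \<noteq> 0 \<and> (\<exists>u<v. Poly_Mapping.lookup m u \<noteq> 0))"
      using True by (auto simp: nonedge_monomial_def less_Suc_eq fun_eq_iff)
    moreover have "threshold_betti (Suc v) \<sigma> = (\<lambda>i. threshold_betti v \<sigma> i
        + (\<Sum>u<v. (u + card (\<sigma> \<inter> {u<..<v})) choose (i - 1)))"
      using True by (simp add: threshold_betti_def fun_eq_iff lessThan_Suc add.commute)
    ultimately show ?thesis
      using resolved_by_vertex[OF True _ _ order_refl IH] Suc.prems by (simp add: lessThan_Suc)
  next
    case False
    then have "nonedge_monomial \<sigma> (Suc v) = nonedge_monomial \<sigma> v"
      by (auto simp: nonedge_monomial_def less_Suc_eq fun_eq_iff)
    moreover have "threshold_betti (Suc v) \<sigma> = threshold_betti v \<sigma>"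
      using False by (simp add: threshold_betti_def fun_eq_iff lessThan_Suc)
    ultimately show ?thesis using IH by simp
  qed
qed

section \<open>From the graph to its Betti numbers\<close>

lemma complement_edge_ideal_threshold_graph:
  "(complement_edge_ideal (threshold_graph n \<sigma>) :: 'k::field polynomial set)
    = monomial_ideal {0..n} (nonedge_monomial \<sigma> (n + 1))"
proof -
  \<comment> \<open>Adjacency is decided by the larger endpoint, so each unordered nonedge is listed
    with \<open>u < v\<close>.\<close>
  let ?M = "(\<lambda>(u, v). variable u + variable v) ` {(u, v). u < v \<and> v \<le> n \<and> v \<in> \<sigma>}"
  have edge: "{u, v} \<in> snd (threshold_graph n \<sigma>) \<longleftrightarrow> v \<notin> \<sigma>" if "u < v" "v \<le> n" for u v
    using that by (auto simp: threshold_graph_def doubleton_eq_iff)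
  have var: "poly_var u * poly_var v = (Poly_Mapping.single (variable u + variable v) 1 :: 'k polynomial)" for u v
    by (simp add: poly_var_def mult_single)
  have "{poly_var u * poly_var v | u v. u \<in> {0..n} \<and> v \<in> {0..n} \<and> u \<noteq> v \<and> {u, v} \<notin> snd (threshold_graph n \<sigma>)}
      = (\<lambda>q. Poly_Mapping.single q 1 :: 'k polynomial) ` ?M" (is "?A = ?B")
  proof (intro equalityI subsetI)
    fix f assume "f \<in> ?A"
    then obtain u v where uv: "f = poly_var u * poly_var v" "u \<le> n" "v \<le> n" "u \<noteq> v"
      "{u, v} \<notin> snd (threshold_graph n \<sigma>)" by auto
    show "f \<in> ?B"
    proof (cases "u < v")
      case True
      then show ?thesis using uv edge[of u v] var by (force simp: image_iff)
    next
      case False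
      then have "v < u" using uv by auto
      then show ?thesis using uv edge[of v u] var[of v u]
        by (force simp: image_iff insert_commute mult.commute)
    qed
  next
    fix f assume "f \<in> ?B"
    then obtain u v where "f = poly_var u * poly_var v" "u < v" "v \<le> n" "v \<in> \<sigma>" by (auto simp: var)
    then show "f \<in> ?A" using edge[of u v] by force
  qed
  moreover have "fst (threshold_graph n \<sigma>) = {0..n}" by (simp add: threshold_graph_def)
  ultimately have "complement_edge_ideal (threshold_graph n \<sigma>)
      = (ideal_gen {0..n} ((\<lambda>q. Poly_Mapping.single q 1) ` ?M) :: 'k polynomial set)"
    by (simp add: complement_edge_ideal_def)
  also have "\<dots> = monomial_ideal {0..n} (\<lambda>m. \<exists>q\<in>?M. \<exists>t. m = q + t)"
  proof (rule ideal_gen_monomials)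
    have "{(u, v). u < v \<and> v \<le> n \<and> v \<in> \<sigma>} \<subseteq> {..n} \<times> {..n}" by auto
    then show "finite ?M" by (intro finite_imageI) (rule finite_subset, auto)
  qed (auto simp: keys_add_nat)
  also have "(\<lambda>m. \<exists>q\<in>?M. \<exists>t. m = q + t) = nonedge_monomial \<sigma> (n + 1)"
  proof
    fix m
    have "(\<exists>q\<in>?M. \<exists>t. m = q + t) \<longleftrightarrow> (\<exists>u v. u < v \<and> v \<le> n \<and> v \<in> \<sigma> \<and> (\<exists>t. m = variable u + variable v + t))"
      by force
    also have "\<dots> \<longleftrightarrow> (\<exists>u v. u < v \<and> v \<le> n \<and> v \<in> \<sigma> \<and>
        (Poly_Mapping.lookup m u \<noteq> 0 \<and> Poly_Mapping.lookup m v \<noteq> 0))"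
      by (intro iff_exI conj_cong refl two_variables_le_iff) auto
    also have "\<dots> \<longleftrightarrow> nonedge_monomial \<sigma> (n + 1) m"
      by (auto simp: nonedge_monomial_def less_Suc_eq_le)
    finally show "(\<exists>q\<in>?M. \<exists>t. m = q + t) = nonedge_monomial \<sigma> (n + 1) m" .
  qed
  finally show ?thesis .
qed

lemma linear_betti_threshold_graph:
  assumes "1 \<le> k"
  shows "linear_betti TYPE('k::field) (threshold_graph n \<sigma>) k = threshold_betti (n + 1) \<sigma> k"
proof -
  have "resolved_by TYPE('k) {0..n} (nonedge_monomial \<sigma> (n + 1)) (linear_shape (threshold_betti (n + 1) \<sigma>))"
    by (rule resolved_by_nonedges) auto
  then obtain e D where "graded_resolution {0..n}
      (complement_edge_ideal (threshold_graph n \<sigma>) :: 'k polynomial set)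
      (linear_shape (threshold_betti (n + 1) \<sigma>)) e D"
    by (auto simp: resolved_by_def complement_edge_ideal_threshold_graph)
  from graded_betti_eq[OF this, of k "int k + 1"] assms show ?thesis
    by (simp add: linear_betti_def threshold_graph_def linear_shape_def count_list_eq_length_filter)
qed

section \<open>Expectation\<close>

text \<open>The (a + b + 1)-subsets of {0..<v} are sorted by the element u with a elements below and
  b above it. The induction keeps \<open>b\<close> arbitrary because Pascal's rule involves both
  \<open>b\<close> and its predecessor.\<close>

lemma sum_choose_mult_choose:
  "(\<Sum>u<v. (u choose a) * ((v - 1 - u) choose b)) = v choose (a + b + 1)"
proof (induction v arbitrary: b)
  case 0
  then show ?case by simp
next
  case (Suc v)
  show ?case
  proof (cases b)
    case 0
    then show ?thesis
      using sum_choose_upper[of a v] by (simp add: lessThan_Suc_atMost)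
  next
    case (Suc c)
    have "(\<Sum>u<Suc v. (u choose a) * ((Suc v - 1 - u) choose b))
        = (\<Sum>u<v. (u choose a) * ((v - u) choose Suc c))"
      by (simp add: Suc)
    also have "\<dots> = (\<Sum>u<v. (u choose a) * ((v - 1 - u) choose c) + (u choose a) * ((v - 1 - u) choose Suc c))"
    proof (rule sum.cong[OF refl])
      fix u assume "u \<in> {..<v}"
      then have "v - u = Suc (v - 1 - u)" by auto
      then show "(u choose a) * ((v - u) choose Suc c)
          = (u choose a) * ((v - 1 - u) choose c) + (u choose a) * ((v - 1 - u) choose Suc c)"
        by (simp add: algebra_simps)
    qed
    also have "\<dots> = Suc v choose (a + b + 1)"
      using Suc.IH[of c] Suc.IH[of "Suc c"] by (simp add: sum.distrib Suc)
    finally show ?thesis .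
  qed
qed

text \<open>Here the (a + b + 2)-subsets of {0..n} are sorted by their largest element v and then by
  u.\<close>

lemma sum_sum_choose_mult_choose:
  "(\<Sum>v\<le>n. \<Sum>u<v. (u choose a) * ((v - 1 - u) choose b)) = (n + 1) choose (a + b + 2)"
  unfolding sum_choose_mult_choose using sum_choose_upper[of "a + b + 1" n] by simp

section \<open>Expectations over the random subset\<close>

lemma finite_set_random_subset: "finite (set_pmf (random_subset n p))"
proof -
  have "set_pmf (random_subset n p) \<subseteq> Pow {1..n}"
    by (auto simp: random_subset_def)
  then show ?thesis by (rule finite_subset) simp
qed

text \<open>With factors 1 outside \<open>B\<close> the indicator is a product over all of {1..n},
  so independence turns its expectation into a product.\<close>

lemma expectation_subset_random_subset:
  assumes "0 \<le> p" "p \<le> 1" "B \<subseteq> {1..n}"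
  shows "measure_pmf.expectation (random_subset n p) (\<lambda>\<sigma>. of_bool (B \<subseteq> \<sigma>)) = p ^ card B"
proof -
  let ?f = "\<lambda>i (b :: bool). if i \<in> B then of_bool b else (1 :: real)"
  have "(of_bool (B \<subseteq> {i \<in> {1..n}. b i}) :: real) = (\<Prod>i\<in>{1..n}. ?f i (b i))" for b
  proof -
    have "(\<Prod>i\<in>{1..n}. ?f i (b i)) = (\<Prod>i\<in>B. of_bool (b i))"
      using assms(3) by (intro prod.mono_neutral_cong_right) auto
    also have "\<dots> = of_bool (\<forall>i\<in>B. b i)"
      using finite_subset[OF assms(3)] by (induction B rule: finite_induct) auto
    also have "(\<forall>i\<in>B. b i) \<longleftrightarrow> B \<subseteq> {i \<in> {1..n}. b i}"
      using assms(3) by auto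
    finally show ?thesis by simp
  qed
  then have "measure_pmf.expectation (random_subset n p) (\<lambda>\<sigma>. of_bool (B \<subseteq> \<sigma>))
      = measure_pmf.expectation (Pi_pmf {1..n} False (\<lambda>_. bernoulli_pmf p)) (\<lambda>b. \<Prod>i\<in>{1..n}. ?f i (b i))"
    by (simp add: random_subset_def)
  also have "\<dots> = (\<Prod>i\<in>{1..n}. measure_pmf.expectation (bernoulli_pmf p) (?f i))"
    by (rule expectation_prod_Pi_pmf) (auto intro!: integrable_measure_pmf_finite)
  also have "\<dots> = (\<Prod>i\<in>{1..n}. if i \<in> B then p else 1)"
    using assms(1,2) by (intro prod.cong) auto
  also have "\<dots> = (\<Prod>i\<in>B. p)"
    using assms(3) by (intro prod.mono_neutral_cong_right) auto
  finally show ?thesis by simp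
qed

text \<open>The binomial coefficient is expanded by Vandermonde's identity, and \<open>card (\<sigma> \<inter> S) choose s\<close>
  counts the \<open>s\<close>-subsets of \<open>S\<close> contained in \<open>\<sigma>\<close>.\<close>

lemma expectation_choose_card_inter:
  assumes "0 \<le> p" "p \<le> 1" "S \<subseteq> {1..n}" "v \<in> {1..n} - S"
  shows "measure_pmf.expectation (random_subset n p)
      (\<lambda>\<sigma>. of_bool (v \<in> \<sigma>) * real ((u + card (\<sigma> \<inter> S)) choose k))
    = (\<Sum>s\<le>k. real ((u choose (k - s)) * (card S choose s)) * p ^ (s + 1))"
proof -
  have finS: "finite S" using assms(3) finite_subset by blast
  let ?A = "\<lambda>s. {A. A \<subseteq> S \<and> card A = s}"
  have finA: "finite (?A s)" for s using finS by simp
  have "of_bool (v \<in> \<sigma>) * real ((u + card (\<sigma> \<inter> S)) choose k)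
      = (\<Sum>s\<le>k. \<Sum>A\<in>?A s. real (u choose (k - s)) * of_bool (insert v A \<subseteq> \<sigma>))" for \<sigma>
  proof -
    have vd: "(u + card (\<sigma> \<inter> S)) choose k = (\<Sum>s\<le>k. (card (\<sigma> \<inter> S) choose s) * (u choose (k - s)))"
      by (subst add.commute) (rule vandermonde[symmetric])
    have count: "of_bool (v \<in> \<sigma>) * real (card (\<sigma> \<inter> S) choose s) = (\<Sum>A\<in>?A s. of_bool (insert v A \<subseteq> \<sigma>))" for s
    proof -
      have "(\<Sum>A\<in>?A s. of_bool (insert v A \<subseteq> \<sigma>) :: real) = (\<Sum>A\<in>?A s. if A \<subseteq> \<sigma> then of_bool (v \<in> \<sigma>) else 0)"
        by (intro sum.cong) auto
      also have "\<dots> = of_bool (v \<in> \<sigma>) * real (card {A \<in> ?A s. A \<subseteq> \<sigma>})"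
        using finA by (simp flip: sum.inter_filter)
      also have "{A \<in> ?A s. A \<subseteq> \<sigma>} = {A. A \<subseteq> \<sigma> \<inter> S \<and> card A = s}" by auto
      also have "card \<dots> = card (\<sigma> \<inter> S) choose s" using finS by (intro n_subsets) auto
      finally show ?thesis ..
    qed
    have "of_bool (v \<in> \<sigma>) * real ((u + card (\<sigma> \<inter> S)) choose k)
        = (\<Sum>s\<le>k. real (u choose (k - s)) * (of_bool (v \<in> \<sigma>) * real (card (\<sigma> \<inter> S) choose s)))"
      unfolding vd of_nat_sum of_nat_mult sum_distrib_left by (intro sum.cong refl) (simp only: mult_ac)
    then show ?thesis by (simp only: count sum_distrib_left)
  qed
  then have "measure_pmf.expectation (random_subset n p)
      (\<lambda>\<sigma>. of_bool (v \<in> \<sigma>) * real ((u + card (\<sigma> \<inter> S)) choose k))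
    = (\<Sum>s\<le>k. \<Sum>A\<in>?A s. real (u choose (k - s)) *
        measure_pmf.expectation (random_subset n p) (\<lambda>\<sigma>. of_bool (insert v A \<subseteq> \<sigma>)))"
    by (simp add: integrable_measure_pmf_finite[OF finite_set_random_subset] del: insert_subset)
  also have "\<dots> = (\<Sum>s\<le>k. \<Sum>A\<in>?A s. real (u choose (k - s)) * p ^ (s + 1))"
  proof (intro sum.cong refl)
    fix s A assume A: "A \<in> ?A s"
    \<comment> \<open>As \<open>v\<close> lies outside \<open>S\<close>, the event fixes
      \<open>s + 1\<close> elements of \<sigma>, which explains the exponent.\<close>
    then have "v \<notin> A" "finite A" using assms(4) finS finite_subset by auto
    then have "card (insert v A) = s + 1" using A by simp
    moreover have "insert v A \<subseteq> {1..n}" using A assms(3,4) by auto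
    ultimately show "real (u choose (k - s)) * measure_pmf.expectation (random_subset n p) (\<lambda>\<sigma>. of_bool (insert v A \<subseteq> \<sigma>))
        = real (u choose (k - s)) * p ^ (s + 1)"
      using expectation_subset_random_subset[OF assms(1,2)] by metis
  qed
  also have "\<dots> = (\<Sum>s\<le>k. real ((u choose (k - s)) * (card S choose s)) * p ^ (s + 1))"
    using n_subsets[OF finS] by (simp add: mult_ac)
  finally show ?thesis .
qed

lemma expectation_threshold_betti:
  assumes "0 < p" "p < 1" "1 \<le> k"
  shows "measure_pmf.expectation (random_subset n p) (\<lambda>\<sigma>. real (threshold_betti (n + 1) \<sigma> k))
    = real ((n + 1) choose (k + 1)) * (p * (1 - p ^ k) / (1 - p))"
proof -
  have eq: "real (threshold_betti (n + 1) \<sigma> k)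
      = (\<Sum>v\<le>n. \<Sum>u<v. of_bool (v \<in> \<sigma>) * real ((u + card (\<sigma> \<inter> {u<..<v})) choose (k - 1)))" for \<sigma>
  proof -
    have "threshold_betti (n + 1) \<sigma> k
        = (\<Sum>v\<in>{v \<in> {..n}. v \<in> \<sigma>}. \<Sum>u<v. (u + card (\<sigma> \<inter> {u<..<v})) choose (k - 1))"
      unfolding threshold_betti_def by (intro sum.cong) auto
    also have "\<dots> = (\<Sum>v\<le>n. if v \<in> \<sigma> then \<Sum>u<v. (u + card (\<sigma> \<inter> {u<..<v})) choose (k - 1) else 0)"
      by (rule sum.inter_filter) simp
    also have "real \<dots> = (\<Sum>v\<le>n. \<Sum>u<v. of_bool (v \<in> \<sigma>) * real ((u + card (\<sigma> \<inter> {u<..<v})) choose (k - 1)))"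
      unfolding of_nat_sum by (intro sum.cong refl) simp
    finally show ?thesis .
  qed
  have "measure_pmf.expectation (random_subset n p) (\<lambda>\<sigma>. real (threshold_betti (n + 1) \<sigma> k))
    = (\<Sum>v\<le>n. \<Sum>u<v. measure_pmf.expectation (random_subset n p)
        (\<lambda>\<sigma>. of_bool (v \<in> \<sigma>) * real ((u + card (\<sigma> \<inter> {u<..<v})) choose (k - 1))))"
    unfolding eq
    by (simp only: Bochner_Integration.integral_sum integrable_measure_pmf_finite[OF finite_set_random_subset])
  also have "\<dots> = (\<Sum>v\<le>n. \<Sum>u<v. \<Sum>s\<le>k - 1.
      real ((u choose (k - 1 - s)) * ((v - 1 - u) choose s)) * p ^ (s + 1))"
  proof (intro sum.cong refl)
    fix v u assume "v \<in> {..n}" "u \<in> {..<v}"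
    \<comment> \<open>Vertex 0 is never random, but it cannot occur here: \<open>v\<close> and
      everything in the open interval exceed \<open>u\<close>.\<close>
    then have "{u<..<v} \<subseteq> {1..n}" "v \<in> {1..n} - {u<..<v}" by auto
    moreover have "card {u<..<v} = v - 1 - u" by simp
    ultimately show "measure_pmf.expectation (random_subset n p)
        (\<lambda>\<sigma>. of_bool (v \<in> \<sigma>) * real ((u + card (\<sigma> \<inter> {u<..<v})) choose (k - 1)))
      = (\<Sum>s\<le>k - 1. real ((u choose (k - 1 - s)) * ((v - 1 - u) choose s)) * p ^ (s + 1))"
      using expectation_choose_card_inter[of p "{u<..<v}" n v u "k - 1"] assms by simp
  qed
  also have "\<dots> = (\<Sum>s\<le>k - 1. \<Sum>v\<le>n. \<Sum>u<v.
      real ((u choose (k - 1 - s)) * ((v - 1 - u) choose s)) * p ^ (s + 1))"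
    by (simp only: sum.swap[of _ "{..k - 1}"])
  also have "\<dots> = (\<Sum>s\<le>k - 1. real ((n + 1) choose (k + 1)) * p ^ (s + 1))"
  proof (rule sum.cong[OF refl])
    fix s assume "s \<in> {..k - 1}"
    \<comment> \<open>The two lower indices always add up to \<open>k - 1\<close>, so the
      coefficient is independent of \<open>s\<close> and a geometric sum remains.\<close>
    then have "k - 1 - s + s + 2 = k + 1" using assms(3) by auto
    then have "real (\<Sum>v\<le>n. \<Sum>u<v. (u choose (k - 1 - s)) * ((v - 1 - u) choose s)) = real ((n + 1) choose (k + 1))"
      using sum_sum_choose_mult_choose[of "k - 1 - s" s n] by simp
    then show "(\<Sum>v\<le>n. \<Sum>u<v. real ((u choose (k - 1 - s)) * ((v - 1 - u) choose s)) * p ^ (s + 1))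
        = real ((n + 1) choose (k + 1)) * p ^ (s + 1)"
      by (simp flip: sum_distrib_right)
  qed
  also have "\<dots> = real ((n + 1) choose (k + 1)) * (p * (\<Sum>s<k. p ^ s))"
    using assms(3) lessThan_Suc_atMost[of "k - 1"] by (simp add: sum_distrib_left)
  also have "(\<Sum>s<k. p ^ s) = (1 - p ^ k) / (1 - p)"
    using assms(2) by (intro sum_gp_strict[THEN trans]) simp
  finally show ?thesis by simp
qed

theorem theorem4p12:
  fixes p :: real and k n :: nat
  assumes "0 < p" "p < 1" "1 \<le> k" "k \<le> n"
  shows "measure_pmf.expectation (random_threshold_graph n p)
           (\<lambda>T. real_of_int (anti_lecture_hall TYPE('k::field) T k)) =
         (\<Sum>i=k..n. (-1) ^ (i + k) * real ((n + 1) choose (i + 1)) * real ((i - 1) choose (k - 1))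
                     * (p * (1 - p ^ i) / (1 - p)))"
proof -
  have "real_of_int (anti_lecture_hall TYPE('k) (threshold_graph n \<sigma>) k)
      = (\<Sum>i=k..n. (-1) ^ (i + k) * real ((i - 1) choose (k - 1)) * real (threshold_betti (n + 1) \<sigma> i))" for \<sigma>
  proof -
    have "card (fst (threshold_graph n \<sigma>)) - 1 = n" by (simp add: threshold_graph_def)
    then have "anti_lecture_hall TYPE('k) (threshold_graph n \<sigma>) k
        = (\<Sum>i=k..n. (-1) ^ (k + i) * int ((i - 1) choose (k - 1)) * int (threshold_betti (n + 1) \<sigma> i))"
      unfolding anti_lecture_hall_def Let_def using \<open>1 \<le> k\<close>
      by (intro sum.cong) (auto simp: linear_betti_threshold_graph)
    then show ?thesis by (simp add: add.commute)
  qed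
  \<comment> \<open>The parts of the composition are fixed linear combinations of Betti numbers, so
    linearity of expectation suffices.\<close>
  then have "measure_pmf.expectation (random_threshold_graph n p)
      (\<lambda>T. real_of_int (anti_lecture_hall TYPE('k) T k))
    = (\<Sum>i=k..n. (-1) ^ (i + k) * real ((i - 1) choose (k - 1)) *
        measure_pmf.expectation (random_subset n p) (\<lambda>\<sigma>. real (threshold_betti (n + 1) \<sigma> i)))"
    by (simp add: random_threshold_graph_def integrable_measure_pmf_finite[OF finite_set_random_subset])
  also have "\<dots> = (\<Sum>i=k..n. (-1) ^ (i + k) * real ((n + 1) choose (i + 1)) * real ((i - 1) choose (k - 1))
                     * (p * (1 - p ^ i) / (1 - p)))"
  proof (rule sum.cong[OF refl])
    fix i assume "i \<in> {k..n}"
    then have "1 \<le> i" using \<open>1 \<le> k\<close> by simp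
    then show "(-1) ^ (i + k) * real ((i - 1) choose (k - 1)) *
        measure_pmf.expectation (random_subset n p) (\<lambda>\<sigma>. real (threshold_betti (n + 1) \<sigma> i))
      = (-1) ^ (i + k) * real ((n + 1) choose (i + 1)) * real ((i - 1) choose (k - 1))
        * (p * (1 - p ^ i) / (1 - p))"
      unfolding expectation_threshold_betti[OF assms(1,2) \<open>1 \<le> i\<close>] by (simp only: mult_ac)
  qed
  finally show ?thesis .
qed

end
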